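(* Let $\Gamma$ be a finitely generated group and let $(\Omega,\mu)$ be an ergodic standard Borel probability $\Gamma$-space. Let $\sigma_1,\sigma_2:\Gamma\times\Omega\to\mathrm{Homeo}^+(\mathbb{S}^1)$ be two measurable cocycles and assume that $\sigma_1$ and $\sigma_2$ are semicohomologous. Then $$\mathrm{H}^2_b(\sigma_1)(e^b_{\mathbb{Z}})=\mathrm{H}^2_b(\sigma_2)(e^b_{\mathbb{Z}})$$ in $\mathrm{H}^2_b(\Gamma;\mathrm{L}^\infty(\Omega,\mathbb{Z}))$.
   Context: A standard Borel probability $\Gamma$-space is a standard Borel probability space $(\Omega,\mu)$ with an essentially free, measure preserving action of $\Gamma$; it is ergodic if the action is. Put $H=\mathrm{Homeo}^+(\mathbb{S}^1)$, the group of orientation preserving homeomorphisms of $\mathbb{S}^1\cong\mathbb{R}/\mathbb{Z}$, with the Borel structure of the compact-open topology. A measurable cocycle is a measurable map $\sigma:\Gamma\times\Omega\to H$ with $\sigma(\gamma_1\gamma_2,\omega)=\sigma(\gamma_1,\gamma_2\omega)\sigma(\gamma_2,\omega)$ for every $\gamma_1,\gamma_2\in\Gamma$ and almost every $\omega\in\Omega$. A non-decreasing degree one map $\mathbb{S}^1\to\mathbb{S}^1$ is a (not necessarily continuous) map that weakly preserves the cyclic order of every $k$-tuple of points, for every $k\in\mathbb{N}$; equivalently, it has a lift $\mathbb{R}\to\mathbb{R}$ that is non-decreasing and commutes with integer translations (constant maps are allowed). Semicohomology: $\sigma_1$ is left semicohomologous to $\sigma_2$ (equivalently, $\sigma_2$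 is right semicohomologous to $\sigma_1$) if there is a measurable map $\varphi:\mathbb{S}^1\times\Omega\to\mathbb{S}^1$ such that $\varphi(\omega):=\varphi(\cdot,\omega)$ is a non-decreasing degree one map for almost every $\omega$ and $\sigma_1(\gamma,\omega)\varphi(\omega)=\varphi(\gamma\omega)\sigma_2(\gamma,\omega)$ for every $\gamma\in\Gamma$ and almost every $\omega\in\Omega$. $\sigma_1$ and $\sigma_2$ are semicohomologous if $\sigma_1$ is both left and right semicohomologous to $\sigma_2$. Bounded cohomology: for a discrete group $G$ and a normed $G$-module $A$ with isometric action, $\mathrm{H}^n_b(G;A)$ is the cohomology of the inhomogeneous complex of bounded functions $\overline{\mathrm{C}}^n_b(G;A)=\{f:G^n\to A \text{ bounded}\}$ with coboundary $(\overline\delta f)(g_1,\dots,g_{n+1})=g_1\cdot f(g_2,\dots,g_{n+1})+\sum_{i=1}^n(-1)^if(g_1,\dots,g_ig_{i+1},\dots,g_{n+1})+(-1)^{n+1}f(g_1,\dots,g_n)$. All groups, including $H$, are regarded as discrete here. $\mathbb{Z}$ is a trivial $H$-module; $\mathrm{L}^\infty(\Omega,\mathbb{Z})$ has the sup norm and the action $(\gamma f)(\omega)=f(\gamma^{-1}\omega)$. Bounded Euler class: let $\widetilde H=\mathrm{Homeo}^+_{\mathbb{Z}}(\mathbb{R})$ be the group of orientation preserving homeomorphisms $f$ of $\mathbb{R}$ with $f(x+1)=f(x)+1$, $i:\mathbb{Z}\to\widetilde H$ the inclusion as integer translations, $p:\widetilde H\to H$ the projection, and $\overline s:H\to\widetilde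 H$ the section of $p$ determined by $\overline s(f)(0)\in[0,1)$. Then $\overline\varepsilon:H^2\to\mathbb{Z}$ defined by $\overline s(fg)\,i(\overline\varepsilon(f,g))=\overline s(f)\overline s(g)$ is a bounded cocycle and $e^b_{\mathbb{Z}}=[\overline\varepsilon]\in\mathrm{H}^2_b(H;\mathbb{Z})$. Parametrized Euler class: for a measurable cocycle $\sigma$, $\mathrm{H}^2_b(\sigma):\mathrm{H}^2_b(H;\mathbb{Z})\to\mathrm{H}^2_b(\Gamma;\mathrm{L}^\infty(\Omega,\mathbb{Z}))$ is induced by $\psi\mapsto\big[(\gamma,\lambda)\mapsto\big(\omega\mapsto\psi(\sigma(\gamma^{-1},\omega)^{-1},\sigma(\lambda^{-1},\gamma^{-1}\omega)^{-1})\big)\big]$, and the parametrized Euler class of $\sigma$ is $\mathrm{H}^2_b(\sigma)(e^b_{\mathbb{Z}})$. *)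

theory Defs
  imports "HOL-Probability.Probability" "HOL-Algebra.Group_Action" "HOL-Algebra.Generated_Groups" "HOL-Algebra.FiniteProduct"
begin

section \<open>The circle and its homeomorphisms\<close>

quotient_type circle = real / "\<lambda>x y. x - y \<in> \<int>"
  morphisms circle_rep circle_proj
proof (rule equivpI)
  show "reflp (\<lambda>x y :: real. x - y \<in> \<int>)"
    by (simp add: reflp_def)
  show "symp (\<lambda>x y :: real. x - y \<in> \<int>)"
    by (metis (mono_tags, lifting) Ints_minus minus_diff_eq sympI)
  show "transp (\<lambda>x y :: real. x - y \<in> \<int>)"
    by (rule transpI) (metis Ints_add diff_add_cancel add_diff_eq)
qed

instantiation circle :: topological_space
begin

definition open_circle :: "circle set \<Rightarrow> bool"
  where "open_circle U \<longleftrightarrow> open (circle_proj -` U)"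

instance
  by standard (auto simp: open_circle_def vimage_Union)

end

text \<open>The group of orientation preserving homeomorphisms of the line commuting with
  integer translations.\<close>

definition homeo_line :: "(real \<Rightarrow> real) set"
  where "homeo_line =
    {F. (\<exists>F'. homeomorphism UNIV UNIV F F') \<and> strict_mono F \<and> (\<forall>x. F (x + 1) = F x + 1)}"

definition is_lift :: "(real \<Rightarrow> real) \<Rightarrow> (circle \<Rightarrow> circle) \<Rightarrow> bool"
  where "is_lift F f \<longleftrightarrow> (\<forall>x. circle_proj (F x) = f (circle_proj x))"

definition homeo_circle :: "(circle \<Rightarrow> circle) monoid"
  where "homeo_circle =
    \<lparr>carrier = {f. (\<exists>f'. homeomorphism UNIV UNIV f f') \<and> (\<exists>F\<in>homeo_line. is_lift F f)},
     mult = (\<circ>), one = id\<rparr>"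

definition compact_open_topology :: "('a::topological_space \<Rightarrow> 'b::topological_space) topology"
  where "compact_open_topology = topology_generated_by {{f. f ` K \<subseteq> U} | K U. compact K \<and> open U}"

definition borel_homeo_circle :: "(circle \<Rightarrow> circle) measure"
  where "borel_homeo_circle =
    sigma (carrier homeo_circle)
      {V. openin (subtopology compact_open_topology (carrier homeo_circle)) V}"

text \<open>Tuples of points of the circle are lists. A tuple is weakly cyclically ordered if it
  has lifts \<open>y\<^sub>1 \<le> \<dots> \<le> y\<^sub>k \<le> y\<^sub>1 + 1\<close>.\<close>

definition weakly_cyclically_ordered :: "circle list \<Rightarrow> bool"
  where "weakly_cyclically_ordered xs \<longleftrightarrow>
    (\<exists>ys. map circle_proj ys = xs \<and> sorted ys \<and> (ys \<noteq> [] \<longrightarrow> last ys \<le> hd ys + 1))"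

definition nondecreasing_degree_one :: "(circle \<Rightarrow> circle) \<Rightarrow> bool"
  where "nondecreasing_degree_one f \<longleftrightarrow>
    (\<forall>xs. weakly_cyclically_ordered xs \<longrightarrow> weakly_cyclically_ordered (map f xs))"

lemma circle_proj_eq_iff: "circle_proj x = circle_proj y \<longleftrightarrow> x - y \<in> \<int>"
  by (rule circle.abs_eq_iff)

lemma circle_proj_add_int [simp]: "circle_proj (x + of_int n) = circle_proj x"
  by (simp add: circle_proj_eq_iff)

lemma circle_proj_frac [simp]: "circle_proj (frac x) = circle_proj x"
  by (simp add: circle_proj_eq_iff frac_def)

lemma circle_proj_eqE:
  assumes "circle_proj x = circle_proj y"
  obtains n where "x - y = of_int n"
  using assms by (auto simp: circle_proj_eq_iff elim: Ints_cases)

lemma circle_proj_lift_ge: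
  obtains y where "a \<le> y" "y < a + 1" "circle_proj y = z"
proof -
  obtain x where x: "circle_proj x = z"
    by (metis Quotient_circle Quotient_abs_rep)
  show ?thesis
  proof (rule that)
    show "a \<le> x + of_int \<lceil>a - x\<rceil>" "x + of_int \<lceil>a - x\<rceil> < a + 1"
      by linarith+
    show "circle_proj (x + of_int \<lceil>a - x\<rceil>) = z"
      using x by simp
  qed
qed

text \<open>The equivalent description by lifts.\<close>

lemma nondecreasing_degree_one_iff_lift:
  "nondecreasing_degree_one f \<longleftrightarrow>
    (\<exists>F. mono F \<and> (\<forall>x. F (x + 1) = F x + 1) \<and> is_lift F f)"
proof
  assume "\<exists>F. mono F \<and> (\<forall>x. F (x + 1) = F x + 1) \<and> is_lift F f"
  then obtain F where F: "mono F" "\<And>x. F (x + 1) = F x + 1"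
    "\<And>x. circle_proj (F x) = f (circle_proj x)"
    by (auto simp: is_lift_def)
  show "nondecreasing_degree_one f"
    unfolding nondecreasing_degree_one_def weakly_cyclically_ordered_def
  proof (intro allI impI, elim exE conjE)
    fix xs ys
    assume ys: "map circle_proj ys = xs" "sorted ys" "ys \<noteq> [] \<longrightarrow> last ys \<le> hd ys + 1"
    have "sorted (map F ys)"
      using ys(2) F(1) by (auto simp: sorted_map monoD intro: sorted_wrt_mono_rel[rotated])
    moreover have "last (map F ys) \<le> hd (map F ys) + 1" if "ys \<noteq> []"
      using ys(3) that F(2)[of "hd ys"] monoD[OF F(1), of "last ys" "hd ys + 1"]
      by (simp add: last_map hd_map)
    ultimately show "\<exists>ys. map circle_proj ys = map f xs \<and> sorted ys \<and>
        (ys \<noteq> [] \<longrightarrow> last ys \<le> hd ys + 1)"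
      using ys(1) F(3) by (intro exI[of _ "map F ys"]) auto
  qed
next
  assume f: "nondecreasing_degree_one f"
  define g where "g = (\<lambda>t. f (circle_proj t))"
  obtain a where a: "circle_proj a = g 0"
    using circle_proj_lift_ge by metis
  have "\<exists>y. a \<le> y \<and> y < a + 1 \<and> circle_proj y = g t" for t
    using circle_proj_lift_ge by metis
  then obtain e where e: "\<And>t. a \<le> e t" "\<And>t. e t < a + 1" "\<And>t. circle_proj (e t) = g t"
    by metis
  have congr: "y = a \<or> y = a + 1" if y: "a \<le> y" "y \<le> a + 1" "circle_proj y = g 0" for y
  proof -
    obtain n where n: "y - a = of_int n"
      using circle_proj_eqE[of y a] y(3) a by auto
    then have "0 \<le> n" "n \<le> 1"
      using y(1,2) by linarith+
    then have "n = 0 \<or> n = 1" by auto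
    then show ?thesis using n by auto
  qed
  have uniq: "y = e t" if y: "a \<le> y" "y \<le> a + 1" "circle_proj y = g t" "g t \<noteq> g 0" for y t
  proof -
    obtain n where n: "y - e t = of_int n"
      using circle_proj_eqE[of y "e t"] y(3) e(3) by auto
    have "y \<noteq> a + 1"
      using y a circle_proj_add_int[of a 1] by auto
    then have "n < 1" "n > -1"
      using y(1,2) e(1,2)[of t] n by linarith+
    then have "n = 0" by simp
    then show ?thesis using n by simp
  qed
  have lifts: "\<exists>b c d. a \<le> b \<and> b \<le> c \<and> c \<le> d \<and> d \<le> a + 1 \<and>
      circle_proj b = g r \<and> circle_proj c = g s \<and> circle_proj d = g t"
    if "0 \<le> r" "r \<le> s" "s \<le> t" "t \<le> 1" for r s t
  proof -
    have "weakly_cyclically_ordered (map circle_proj [0, r, s, t])"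
      unfolding weakly_cyclically_ordered_def
      using that by (intro exI[of _ "[0, r, s, t]"]) auto
    then have "weakly_cyclically_ordered [g 0, g r, g s, g t]"
      using f unfolding nondecreasing_degree_one_def g_def by fastforce
    then obtain ys where ys: "map circle_proj ys = [g 0, g r, g s, g t]" "sorted ys"
      "ys \<noteq> [] \<longrightarrow> last ys \<le> hd ys + 1"
      unfolding weakly_cyclically_ordered_def by (elim exE conjE) (rule that)
    then obtain p b c d where p: "ys = [p, b, c, d]"
      by (auto simp: map_eq_Cons_conv)
    have "circle_proj a = circle_proj p"
      using ys(1) p a by simp
    then obtain n where "a - p = of_int n"
      by (rule circle_proj_eqE)
    then show ?thesis
      using ys p
      by (intro exI[of _ "b + of_int n"] exI[of _ "c + of_int n"] exI[of _ "d + of_int n"]) auto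
  qed
  define J where "J = (\<lambda>t. \<exists>s. 0 < s \<and> s < t \<and> g s \<noteq> g 0)"
  define h where "h = (\<lambda>t. if g t = g 0 then (if J t then a + 1 else a) else e t)"
  have h_bounds: "a \<le> h t" "h t \<le> a + 1" for t
    using e[of t] by (auto simp: h_def)
  have h_proj: "circle_proj (h t) = g t" for t
    using e(3) a circle_proj_add_int[of a 1] by (auto simp: h_def)
  have h_mono: "h s \<le> h t" if st: "0 \<le> s" "s \<le> t" "t < 1" for s t
  proof (cases "s = t")
    case False
    then have lt: "s < t" using st by simp
    show ?thesis
    proof (cases "g s = g 0")
      case True
      show ?thesis
      proof (cases "J s")
        case True
        then obtain r where r: "0 < r" "r < s" "g r \<noteq> g 0" by (auto simp: J_def)
        have "g t = g 0"
        proof (rule ccontr)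
          assume gt: "g t \<noteq> g 0"
          obtain b c d where bcd: "a \<le> b" "b \<le> c" "c \<le> d" "d \<le> a + 1" "circle_proj b = g r"
            "circle_proj c = g s" "circle_proj d = g t"
            using lifts[of r s t] r st by auto
          have "b \<noteq> a" using bcd a r by auto
          then have "c = a + 1" using congr[of c] bcd \<open>g s = g 0\<close> by auto
          then have "d = a + 1" using bcd by auto
          then show False using gt bcd a circle_proj_add_int[of a 1] by auto
        qed
        moreover have "J t" unfolding J_def using r lt by (intro exI[of _ r]) simp
        ultimately have "h t = a + 1" by (simp add: h_def)
        then show ?thesis using h_bounds by simp
      next
        case False
        then have "h s = a" using \<open>g s = g 0\<close> by (simp add: h_def)
        then show ?thesis using h_bounds by simp
      qed
    next
      case gs: False
      then have "s \<noteq> 0" by auto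
      then have "J t" unfolding J_def using st lt gs by (intro exI[of _ s]) simp
      show ?thesis
      proof (cases "g t = g 0")
        case True
        then show ?thesis using \<open>J t\<close> h_bounds by (simp add: h_def)
      next
        case gt: False
        obtain b c d where bcd: "a \<le> b" "b \<le> c" "c \<le> d" "d \<le> a + 1" "circle_proj b = g 0"
          "circle_proj c = g s" "circle_proj d = g t"
          using lifts[of 0 s t] st by auto
        then have "c = e s" "d = e t" using uniq gs gt by auto
        then show ?thesis using bcd gs gt by (simp add: h_def)
      qed
    qed
  qed auto
  define F where "F = (\<lambda>x. h (frac x) + of_int \<lfloor>x\<rfloor>)"
  have "F x \<le> F y" if "x \<le> y" for x y
  proof (cases "\<lfloor>x\<rfloor> = \<lfloor>y\<rfloor>")
    case True
    then have "frac x \<le> frac y" using that by (simp add: frac_def)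
    then show ?thesis using True h_mono[of "frac x" "frac y"] frac_lt_1[of y] by (simp add: F_def)
  next
    case False
    then have "\<lfloor>x\<rfloor> + 1 \<le> \<lfloor>y\<rfloor>" using floor_mono[OF that] by simp
    then have "of_int \<lfloor>x\<rfloor> + 1 \<le> (of_int \<lfloor>y\<rfloor> :: real)" by linarith
    then show ?thesis using h_bounds[of "frac x"] h_bounds[of "frac y"] by (simp add: F_def)
  qed
  moreover have "F (x + 1) = F x + 1" for x
    by (simp add: F_def frac_def)
  moreover have "is_lift F f"
    by (simp add: is_lift_def F_def h_proj) (simp add: g_def)
  ultimately show "\<exists>F. mono F \<and> (\<forall>x. F (x + 1) = F x + 1) \<and> is_lift F f"
    by (intro exI[of _ F]) (auto simp: mono_def)
qed


section \<open>Bounded cohomology of discrete groups\<close>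

text \<open>A normed module over a group is an abelian group, written multiplicatively as a
  \<open>monoid\<close> record, with a norm and an action.\<close>

record ('a, 'g) normed_module = "'a monoid" +
  mnorm :: "'a \<Rightarrow> real"
  act :: "'g \<Rightarrow> 'a \<Rightarrow> 'a"

text \<open>Elements of \<open>G\<^sup>n\<close> are lists of length \<open>n\<close>.\<close>

definition tuples :: "('g, 'm) monoid_scheme \<Rightarrow> nat \<Rightarrow> 'g list set"
  where "tuples G n = {xs. length xs = n \<and> set xs \<subseteq> carrier G}"

definition bounded_cochains ::
  "('g, 'm) monoid_scheme \<Rightarrow> ('a, 'g) normed_module \<Rightarrow> nat \<Rightarrow> ('g list \<Rightarrow> 'a) set"
  where "bounded_cochains G A n =
    {f \<in> tuples G n \<rightarrow>\<^sub>E carrier A. \<exists>C. \<forall>xs\<in>tuples G n. mnorm A (f xs) \<le> C}"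

definition cochain_group ::
  "('g, 'm) monoid_scheme \<Rightarrow> ('a, 'g) normed_module \<Rightarrow> nat \<Rightarrow> ('g list \<Rightarrow> 'a) monoid"
  where "cochain_group G A n =
    \<lparr>carrier = bounded_cochains G A n,
     mult = (\<lambda>f f'. \<lambda>xs\<in>tuples G n. f xs \<otimes>\<^bsub>A\<^esub> f' xs),
     one = (\<lambda>xs\<in>tuples G n. \<one>\<^bsub>A\<^esub>)\<rparr>"

text \<open>\<open>merge_at G i [g\<^sub>1, \<dots>, g\<^sub>n\<^sub>+\<^sub>1] = [g\<^sub>1, \<dots>, g\<^sub>i g\<^sub>i\<^sub>+\<^sub>1, \<dots>, g\<^sub>n\<^sub>+\<^sub>1]\<close>, for \<open>1 \<le> i \<le> n\<close>.\<close>

definition merge_at :: "('g, 'm) monoid_scheme \<Rightarrow> nat \<Rightarrow> 'g list \<Rightarrow> 'g list"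
  where "merge_at G i xs =
    take (i - 1) xs @ (xs ! (i - 1) \<otimes>\<^bsub>G\<^esub> xs ! i) # drop (i + 1) xs"

definition coboundary ::
  "('g, 'm) monoid_scheme \<Rightarrow> ('a, 'g) normed_module \<Rightarrow> nat \<Rightarrow> ('g list \<Rightarrow> 'a) \<Rightarrow> 'g list \<Rightarrow> 'a"
  where "coboundary G A n f =
    (\<lambda>xs\<in>tuples G (Suc n).
      act A (hd xs) (f (tl xs))
      \<otimes>\<^bsub>A\<^esub> (\<Otimes>\<^bsub>A\<^esub>i\<in>{1..n}. f (merge_at G i xs) [^]\<^bsub>A\<^esub> ((-1) ^ i :: int))
      \<otimes>\<^bsub>A\<^esub> f (butlast xs) [^]\<^bsub>A\<^esub> ((-1) ^ (n + 1) :: int))"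

definition bounded_cocycles ::
  "('g, 'm) monoid_scheme \<Rightarrow> ('a, 'g) normed_module \<Rightarrow> nat \<Rightarrow> ('g list \<Rightarrow> 'a) set"
  where "bounded_cocycles G A n =
    {f \<in> bounded_cochains G A n. coboundary G A n f = \<one>\<^bsub>cochain_group G A (Suc n)\<^esub>}"

definition bounded_coboundaries ::
  "('g, 'm) monoid_scheme \<Rightarrow> ('a, 'g) normed_module \<Rightarrow> nat \<Rightarrow> ('g list \<Rightarrow> 'a) set"
  where "bounded_coboundaries G A n =
    (case n of 0 \<Rightarrow> {\<one>\<^bsub>cochain_group G A 0\<^esub>} | Suc m \<Rightarrow> coboundary G A m ` bounded_cochains G A m)"

definition bounded_cohomology ::
  "('g, 'm) monoid_scheme \<Rightarrow> ('a, 'g) normed_module \<Rightarrow> nat \<Rightarrow> ('g list \<Rightarrow> 'a) set monoid"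
  where "bounded_cohomology G A n =
    (cochain_group G A n)\<lparr>carrier := bounded_cocycles G A n\<rparr> Mod bounded_coboundaries G A n"

definition cohomology_class ::
  "('g, 'm) monoid_scheme \<Rightarrow> ('a, 'g) normed_module \<Rightarrow> nat \<Rightarrow> ('g list \<Rightarrow> 'a) \<Rightarrow> ('g list \<Rightarrow> 'a) set"
  where "cohomology_class G A n f = bounded_coboundaries G A n #>\<^bsub>cochain_group G A n\<^esub> f"

definition trivial_int_module :: "(int, 'g) normed_module"
  where "trivial_int_module =
    \<lparr>carrier = UNIV, mult = (+), one = 0, mnorm = (\<lambda>n. \<bar>of_int n\<bar>), act = (\<lambda>g n. n)\<rparr>"


section \<open>The bounded Euler class\<close>

definition lift_section :: "(circle \<Rightarrow> circle) \<Rightarrow> real \<Rightarrow> real"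
  where "lift_section f = (THE F. F \<in> homeo_line \<and> is_lift F f \<and> F 0 \<in> {0..<1})"

definition translation :: "int \<Rightarrow> real \<Rightarrow> real"
  where "translation n = (\<lambda>x. x + of_int n)"

definition euler_cocycle :: "(circle \<Rightarrow> circle) \<Rightarrow> (circle \<Rightarrow> circle) \<Rightarrow> int"
  where "euler_cocycle f g =
    (THE n. lift_section (f \<circ> g) \<circ> translation n = lift_section f \<circ> lift_section g)"

definition bounded_euler_class :: "((circle \<Rightarrow> circle) list \<Rightarrow> int) set"
  where "bounded_euler_class = cohomology_class homeo_circle trivial_int_module 2
    (\<lambda>xs\<in>tuples homeo_circle 2. euler_cocycle (xs ! 0) (xs ! 1))"


section \<open>Ergodic standard Borel probability spaces with an action\<close>

definition finitely_generated_group :: "('g, 'm) monoid_scheme \<Rightarrow> bool"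
  where "finitely_generated_group G \<longleftrightarrow>
    group G \<and> (\<exists>S. finite S \<and> S \<subseteq> carrier G \<and> generate G S = carrier G)"

definition standard_borel :: "'w measure \<Rightarrow> bool"
  where "standard_borel M \<longleftrightarrow>
    (\<exists>X. completely_metrizable_space X \<and> second_countable X \<and> topspace X = space M \<and>
      sets M = sigma_sets (topspace X) {U. openin X U})"

definition standard_borel_probability_action ::
  "('g, 'm) monoid_scheme \<Rightarrow> 'w measure \<Rightarrow> ('g \<Rightarrow> 'w \<Rightarrow> 'w) \<Rightarrow> bool"
  where "standard_borel_probability_action G M \<alpha> \<longleftrightarrow>
    standard_borel M \<and> prob_space M \<and>
    group_action G (space M) \<alpha> \<and>
    (\<forall>\<gamma>\<in>carrier G. \<alpha> \<gamma> \<in> M \<rightarrow>\<^sub>M M \<and> distr M M (\<alpha> \<gamma>) = M) \<and>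
    (AE \<omega> in M. \<forall>\<gamma>\<in>carrier G. \<alpha> \<gamma> \<omega> = \<omega> \<longrightarrow> \<gamma> = \<one>\<^bsub>G\<^esub>)"

definition ergodic_action ::
  "('g, 'm) monoid_scheme \<Rightarrow> 'w measure \<Rightarrow> ('g \<Rightarrow> 'w \<Rightarrow> 'w) \<Rightarrow> bool"
  where "ergodic_action G M \<alpha> \<longleftrightarrow>
    (\<forall>A\<in>sets M. (\<forall>\<gamma>\<in>carrier G. \<alpha> \<gamma> -` A \<inter> space M = A) \<longrightarrow> measure M A = 0 \<or> measure M A = 1)"


section \<open>The module of essentially bounded integer valued functions\<close>

definition linf_fun_group :: "'w measure \<Rightarrow> ('w \<Rightarrow> int) monoid"
  where "linf_fun_group M =
    \<lparr>carrier = {f \<in> M \<rightarrow>\<^sub>M count_space UNIV. \<exists>C. AE \<omega> in M. \<bar>f \<omega>\<bar> \<le> C},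
     mult = (\<lambda>f g \<omega>. f \<omega> + g \<omega>), one = (\<lambda>\<omega>. 0)\<rparr>"

definition null_funs :: "'w measure \<Rightarrow> ('w \<Rightarrow> int) set"
  where "null_funs M = {f \<in> carrier (linf_fun_group M). AE \<omega> in M. f \<omega> = 0}"

definition linf_class :: "'w measure \<Rightarrow> ('w \<Rightarrow> int) \<Rightarrow> ('w \<Rightarrow> int) set"
  where "linf_class M f = null_funs M #>\<^bsub>linf_fun_group M\<^esub> f"

text \<open>The quotient by the functions vanishing almost everywhere, with the essential
  supremum norm and \<open>(\<gamma> f)(\<omega>) = f (\<gamma>\<^sup>-\<^sup>1 \<omega>)\<close>. The image of a coset under \<open>\<gamma>\<close> is saturated
  explicitly, since representatives are unconstrained outside \<open>space M\<close>.\<close>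

definition linf_module ::
  "('g, 'm) monoid_scheme \<Rightarrow> 'w measure \<Rightarrow> ('g \<Rightarrow> 'w \<Rightarrow> 'w) \<Rightarrow> (('w \<Rightarrow> int) set, 'g) normed_module"
  where "linf_module G M \<alpha> =
    monoid.extend (linf_fun_group M Mod null_funs M)
      (normed_module.fields
        (\<lambda>X. Inf {C. 0 \<le> C \<and> (\<exists>f\<in>X. AE \<omega> in M. \<bar>of_int (f \<omega>)\<bar> \<le> C)})
        (\<lambda>\<gamma> X. \<Union>f\<in>X. linf_class M (\<lambda>\<omega>. f (\<alpha> (inv\<^bsub>G\<^esub> \<gamma>) \<omega>))))"


section \<open>Measurable cocycles, semicohomology and the parametrized Euler class\<close>

definition measurable_cocycle ::
  "('g, 'm) monoid_scheme \<Rightarrow> 'w measure \<Rightarrow> ('g \<Rightarrow> 'w \<Rightarrow> 'w) \<Rightarrow> ('g \<Rightarrow> 'w \<Rightarrow> circle \<Rightarrow> circle) \<Rightarrow> bool"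
  where "measurable_cocycle G M \<alpha> \<sigma> \<longleftrightarrow>
    (\<lambda>(\<gamma>, \<omega>). \<sigma> \<gamma> \<omega>) \<in> count_space (carrier G) \<Otimes>\<^sub>M M \<rightarrow>\<^sub>M borel_homeo_circle \<and>
    (\<forall>\<gamma>\<^sub>1\<in>carrier G. \<forall>\<gamma>\<^sub>2\<in>carrier G. AE \<omega> in M.
      \<sigma> (\<gamma>\<^sub>1 \<otimes>\<^bsub>G\<^esub> \<gamma>\<^sub>2) \<omega> = \<sigma> \<gamma>\<^sub>1 (\<alpha> \<gamma>\<^sub>2 \<omega>) \<circ> \<sigma> \<gamma>\<^sub>2 \<omega>)"

definition left_semicohomologous ::
  "('g, 'm) monoid_scheme \<Rightarrow> 'w measure \<Rightarrow> ('g \<Rightarrow> 'w \<Rightarrow> 'w) \<Rightarrow>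
    ('g \<Rightarrow> 'w \<Rightarrow> circle \<Rightarrow> circle) \<Rightarrow> ('g \<Rightarrow> 'w \<Rightarrow> circle \<Rightarrow> circle) \<Rightarrow> bool"
  where "left_semicohomologous G M \<alpha> \<sigma>\<^sub>1 \<sigma>\<^sub>2 \<longleftrightarrow>
    (\<exists>\<phi> :: 'w \<Rightarrow> circle \<Rightarrow> circle.
      (\<lambda>(x, \<omega>). \<phi> \<omega> x) \<in> borel \<Otimes>\<^sub>M M \<rightarrow>\<^sub>M borel \<and>
      (AE \<omega> in M. nondecreasing_degree_one (\<phi> \<omega>)) \<and>
      (\<forall>\<gamma>\<in>carrier G. AE \<omega> in M. \<sigma>\<^sub>1 \<gamma> \<omega> \<circ> \<phi> \<omega> = \<phi> (\<alpha> \<gamma> \<omega>) \<circ> \<sigma>\<^sub>2 \<gamma> \<omega>))"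

definition right_semicohomologous ::
  "('g, 'm) monoid_scheme \<Rightarrow> 'w measure \<Rightarrow> ('g \<Rightarrow> 'w \<Rightarrow> 'w) \<Rightarrow>
    ('g \<Rightarrow> 'w \<Rightarrow> circle \<Rightarrow> circle) \<Rightarrow> ('g \<Rightarrow> 'w \<Rightarrow> circle \<Rightarrow> circle) \<Rightarrow> bool"
  where "right_semicohomologous G M \<alpha> \<sigma>\<^sub>1 \<sigma>\<^sub>2 \<longleftrightarrow> left_semicohomologous G M \<alpha> \<sigma>\<^sub>2 \<sigma>\<^sub>1"

definition semicohomologous ::
  "('g, 'm) monoid_scheme \<Rightarrow> 'w measure \<Rightarrow> ('g \<Rightarrow> 'w \<Rightarrow> 'w) \<Rightarrow>
    ('g \<Rightarrow> 'w \<Rightarrow> circle \<Rightarrow> circle) \<Rightarrow> ('g \<Rightarrow> 'w \<Rightarrow> circle \<Rightarrow> circle) \<Rightarrow> bool"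
  where "semicohomologous G M \<alpha> \<sigma>\<^sub>1 \<sigma>\<^sub>2 \<longleftrightarrow>
    left_semicohomologous G M \<alpha> \<sigma>\<^sub>1 \<sigma>\<^sub>2 \<and> right_semicohomologous G M \<alpha> \<sigma>\<^sub>1 \<sigma>\<^sub>2"

definition cocycle_pullback ::
  "('g, 'm) monoid_scheme \<Rightarrow> 'w measure \<Rightarrow> ('g \<Rightarrow> 'w \<Rightarrow> 'w) \<Rightarrow> ('g \<Rightarrow> 'w \<Rightarrow> circle \<Rightarrow> circle) \<Rightarrow>
    ((circle \<Rightarrow> circle) list \<Rightarrow> int) \<Rightarrow> 'g list \<Rightarrow> ('w \<Rightarrow> int) set"
  where "cocycle_pullback G M \<alpha> \<sigma> \<psi> =
    (\<lambda>xs\<in>tuples G 2. let \<gamma> = xs ! 0; \<eta> = xs ! 1 in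
      linf_class M (\<lambda>\<omega>.
        \<psi> [inv\<^bsub>homeo_circle\<^esub> (\<sigma> (inv\<^bsub>G\<^esub> \<gamma>) \<omega>),
           inv\<^bsub>homeo_circle\<^esub> (\<sigma> (inv\<^bsub>G\<^esub> \<eta>) (\<alpha> (inv\<^bsub>G\<^esub> \<gamma>) \<omega>))]))"

text \<open>The map in degree two bounded cohomology induced by a measurable cocycle. For a cochain
  \<open>\<psi>\<close> on the discrete group \<open>homeo_circle\<close> that is not measurable, the functions defining its
  pullback need not be measurable, hence need not define elements of the coefficient module. So
  the class of the pullback is taken for a Borel representative \<open>\<psi>\<close>. It does not depend on this
  choice: a bounded integer valued function \<open>\<beta>\<close> on a group satisfies
  \<open>\<beta> f = lim\<^sub>n (1/n) \<Sum>\<^sub>k\<^sub><\<^sub>n \<delta>\<beta> (f\<^sup>k, f)\<close>, hence is Borel if its coboundary \<open>\<delta>\<beta>\<close> is.\<close>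

definition borel_cochain2 :: "((circle \<Rightarrow> circle) list \<Rightarrow> int) \<Rightarrow> bool"
  where "borel_cochain2 \<psi> \<longleftrightarrow>
    (\<lambda>(f, g). \<psi> [f, g]) \<in> borel_homeo_circle \<Otimes>\<^sub>M borel_homeo_circle \<rightarrow>\<^sub>M count_space UNIV"

definition cohomology_map2 ::
  "('g, 'm) monoid_scheme \<Rightarrow> 'w measure \<Rightarrow> ('g \<Rightarrow> 'w \<Rightarrow> 'w) \<Rightarrow> ('g \<Rightarrow> 'w \<Rightarrow> circle \<Rightarrow> circle) \<Rightarrow>
    ((circle \<Rightarrow> circle) list \<Rightarrow> int) set \<Rightarrow> ('g list \<Rightarrow> ('w \<Rightarrow> int) set) set"
  where "cohomology_map2 G M \<alpha> \<sigma> c =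
    (THE d. \<exists>\<psi>\<in>c. borel_cochain2 \<psi> \<and>
      d = cohomology_class G (linf_module G M \<alpha>) 2 (cocycle_pullback G M \<alpha> \<sigma> \<psi>))"

end

theory Submission
  imports Defs
begin

text \<open>Write \<open>a\<^sub>i(\<gamma>, \<omega>) = \<sigma>\<^sub>i(\<gamma>\<^sup>-\<^sup>1, \<omega>)\<^sup>-\<^sup>1\<close>, and lift a semiconjugacy \<open>\<phi>(\<omega>)\<close> to a monotone map \<open>\<Phi>(\<omega>)\<close>
  of the line, measurably in \<open>\<omega>\<close>. A map that is not constant off one point has only one lift up to
  integer translations, so the lifts of \<open>a\<^sub>1(\<gamma>, \<omega>) \<phi>(\<gamma>\<^sup>-\<^sup>1\<omega>) = \<phi>(\<omega>) a\<^sub>2(\<gamma>, \<omega>)\<close> differ by an integer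
  \<open>n(\<gamma>)(\<omega>)\<close>. This is a bounded cochain, and its coboundary is the difference of the two pulled back
  Euler cocycles. Where \<open>\<phi>(\<omega>)\<close> is constant off one point, its generic value is an invariant section
  for \<open>\<sigma>\<^sub>1\<close>, and the semiconjugacy in the other direction maps it to an invariant section for \<open>\<sigma>\<^sub>2\<close>;
  placing the jump of the lift at the latter gives the same conclusion. The dichotomy is invariant, so
  it can be made pointwise in \<open>\<omega>\<close>.

  Every Borel cocycle in the bounded Euler class differs from the Euler cocycle by \<open>\<delta>\<beta>\<close> with \<open>\<beta>\<close>
  bounded and then necessarily Borel, so \<open>\<beta>(a\<^sub>1) - \<beta>(a\<^sub>2)\<close> accounts for the choice of the cocycle.\<close>

section \<open>The circle\<close>

text \<open>One semiconjugacy cannot suffice: if \<open>\<sigma>\<^sub>1\<close> is trivial, a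
  constant \<open>\<phi>\<close> intertwines it with every \<open>\<sigma>\<^sub>2\<close>. On lifts
  the defect shows as follows. A constant map has the lifts \<open>c + floor (x - z)\<close> for
  every position \<open>z\<close> of the jump, and for different \<open>z\<close> these need not
  differ by an integer. Precomposing with a homeomorphism of the line moves the jump, so a choice of
  lifts is compatible with the cocycles when its jumps follow the second cocycle. This is what the
  transported section provides. The other obstacle is measurability. The section of
  \<open>homeo_line\<close> and the lifts of \<open>\<phi>(\<omega>)\<close> are given by
  descriptions or by mere existence, and \<open>\<beta>\<close> is a cochain on a discrete group.
  Each is therefore rewritten as an explicit expression or a limit in which only countably many
  conditions on Borel functions occur. Boundedness of \<open>n(\<gamma>)\<close> comes from
  normalising all lifts to take values in one fixed interval on [0, 1).\<close>

lemma degree_one_int: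
  fixes F :: "real \<Rightarrow> real"
  assumes "\<And>x. F (x + 1) = F x + 1"
  shows "F (x + of_int n) = F x + of_int n"
proof (induction n rule: int_induct[where k = 0])
  case (step1 i)
  then show ?case using assms[of "x + of_int i"] by (simp add: add.assoc)
next
  case (step2 i)
  then show ?case using assms[of "x + of_int (i - 1)"] by (simp add: algebra_simps)
qed simp

lemma degree_one_frac:
  fixes F :: "real \<Rightarrow> real"
  assumes "\<And>x. F (x + 1) = F x + 1"
  shows "F x = F (frac x) + of_int \<lfloor>x\<rfloor>"
  using degree_one_int[of F "frac x" "\<lfloor>x\<rfloor>", OF assms] by (simp add: frac_def)

section \<open>A coordinate on the circle\<close>

lemma circle_proj_surj: obtains x where "circle_proj x = z" "0 \<le> x" "x < 1"
  using circle_proj_lift_ge[of 0 z] by auto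

text \<open>\<open>circle_rep\<close> is an arbitrary representative; its fractional part is
  independent of that choice. Measurability on the circle is reduced to the line through this
  coordinate.\<close>

definition circle_coord :: "circle \<Rightarrow> real"
  where "circle_coord z = frac (circle_rep z)"

lemma circle_proj_coord [simp]: "circle_proj (circle_coord z) = z"
  by (simp add: circle_coord_def) (metis Quotient_circle Quotient_abs_rep)

lemma circle_coord_bounds: "0 \<le> circle_coord z" "circle_coord z < 1"
  by (auto simp: circle_coord_def frac_lt_1)

lemma circle_coord_proj: "circle_coord (circle_proj x) = frac x"
proof -
  have "circle_proj (circle_coord (circle_proj x)) = circle_proj x" by simp
  then have "circle_coord (circle_proj x) - x \<in> \<int>"
    by (simp only: circle_proj_eq_iff)
  then have "x - circle_coord (circle_proj x) \<in> \<int>" by (metis Ints_minus minus_diff_eq)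
  then have "frac x = circle_coord (circle_proj x)"
    by (simp add: frac_unique_iff circle_coord_bounds)
  then show ?thesis by simp
qed

lemma circle_coord_eq_iff: "circle_coord z = circle_coord w \<longleftrightarrow> z = w"
  by (metis circle_proj_coord)

section \<open>Topology and Borel structure of the circle\<close>

lemma continuous_circle_proj: "continuous_on UNIV circle_proj"
  by (auto simp: continuous_on_open_vimage open_circle_def)

lemma vimage_proj_image:
  "circle_proj -` (circle_proj ` A) = (\<Union>n. (\<lambda>x. x + of_int n) -` A)"
proof (intro Set.set_eqI iffI)
  fix x assume "x \<in> circle_proj -` (circle_proj ` A)"
  then obtain y where y: "y \<in> A" "circle_proj y = circle_proj x" by auto
  from y(2) obtain n where "y - x = of_int n" by (rule circle_proj_eqE)
  then have "y = x + of_int n" by simp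
  with y(1) show "x \<in> (\<Union>n. (\<lambda>x. x + of_int n) -` A)" by auto
next
  fix x assume "x \<in> (\<Union>n. (\<lambda>x. x + of_int n) -` A)"
  then obtain n where "x + of_int n \<in> A" by auto
  then have "circle_proj (x + of_int n) \<in> circle_proj ` A" by (rule imageI)
  then show "x \<in> circle_proj -` (circle_proj ` A)" by simp
qed

lemma open_proj_image: "open A \<Longrightarrow> open (circle_proj ` A)"
  unfolding open_circle_def vimage_proj_image
  by (intro open_UN ballI open_vimage continuous_intros) auto

text \<open>The coordinate jumps only at \<open>circle_proj 0\<close>: for 0 < c \<le> 1 the
  sublevel set is an open arc together with that point, which is closed because its complement is an
  open arc.\<close>

lemma circle_coord_measurable [measurable]: "circle_coord \<in> borel \<rightarrow>\<^sub>M borel"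
proof (rule borel_measurableI_less)
  fix c :: real
  have op: "open (circle_proj ` {0<..<d})" for d by (intro open_proj_image) auto
  have sing: "{circle_proj 0} \<in> sets borel"
  proof -
    have "- {circle_proj 0} = circle_proj ` {0<..<1}"
    proof (intro Set.set_eqI iffI)
      fix z assume "z \<in> - {circle_proj 0}"
      moreover obtain x where "circle_proj x = z" "0 \<le> x" "x < 1" by (rule circle_proj_surj)
      ultimately show "z \<in> circle_proj ` {0<..<1}" by (cases "x = 0") auto
    next
      fix z assume "z \<in> circle_proj ` {0<..<1}"
      then show "z \<in> - {circle_proj 0}"
        by (auto simp: circle_proj_eq_iff elim!: Ints_cases)
    qed
    then have "closed {circle_proj 0}" using op by (metis closed_def)
    then show ?thesis by (rule borel_closed)
  qed
  have "{z. circle_coord z < c} = circle_proj ` {0<..<c} \<union> {circle_proj 0}" if "0 < c" "c \<le> 1"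
  proof (intro Set.set_eqI iffI)
    fix z assume z: "z \<in> {z. circle_coord z < c}"
    show "z \<in> circle_proj ` {0<..<c} \<union> {circle_proj 0}"
    proof (cases "circle_coord z = 0")
      case True
      then show ?thesis using circle_proj_coord[of z] by simp
    next
      case False
      then have "circle_coord z \<in> {0<..<c}" using z circle_coord_bounds(1)[of z] by simp
      then show ?thesis using circle_proj_coord[of z] by (metis UnI1 imageI)
    qed
  next
    fix z assume "z \<in> circle_proj ` {0<..<c} \<union> {circle_proj 0}"
    then obtain x where "z = circle_proj x" "0 \<le> x" "x < c" using \<open>0 < c\<close> by auto
    moreover from this have "frac x = x" using \<open>c \<le> 1\<close> by (simp add: frac_eq)
    ultimately show "z \<in> {z. circle_coord z < c}" by (simp add: circle_coord_proj)
  qed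
  moreover have "{z. circle_coord z < c} = {}" if "c \<le> 0"
    using that circle_coord_bounds(1) by (auto simp: not_less intro: order.trans)
  moreover have "{z. circle_coord z < c} = UNIV" if "1 < c"
    using that circle_coord_bounds(2) by (auto intro: less_trans)
  ultimately show "{z \<in> space borel. circle_coord z < c} \<in> sets borel"
    using sets.Un[OF borel_open[OF op[of c]] sing]
    by (cases "c \<le> 0"; cases "1 < c") (simp_all del: Un_insert_right)
qed

text \<open>The quotient carries only a topology. A continuous injection into the complex plane
  supplies Hausdorff separation and a distance.\<close>

definition circle_embed :: "circle \<Rightarrow> complex"
  where "circle_embed z = cis (2 * pi * circle_coord z)"

lemma circle_embed_proj: "circle_embed (circle_proj x) = cis (2 * pi * x)"
proof -
  have "cis (2 * pi * x) = cis (2 * pi * frac x + 2 * pi * of_int \<lfloor>x\<rfloor>)"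
    by (simp add: frac_def algebra_simps)
  then show ?thesis
    by (simp add: circle_embed_def circle_coord_proj cis_mult[symmetric] cis_multiple_2pi)
qed

lemma continuous_circle_embed: "continuous_on UNIV circle_embed"
proof -
  have "open (circle_embed -` V)" if "open V" for V
  proof -
    have "circle_proj -` (circle_embed -` V) = (\<lambda>x. cis (2 * pi * x)) -` V"
      by (auto simp: circle_embed_proj)
    also have "open \<dots>" using that by (intro open_vimage continuous_intros)
    finally show ?thesis by (simp add: open_circle_def)
  qed
  then show ?thesis by (simp add: continuous_on_open_vimage)
qed

lemma inj_circle_embed: "inj circle_embed"
proof (rule injI)
  fix z w assume "circle_embed z = circle_embed w"
  then have "sin (2 * pi * circle_coord z) = sin (2 * pi * circle_coord w)"
    "cos (2 * pi * circle_coord z) = cos (2 * pi * circle_coord w)"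
    by (auto simp: circle_embed_def complex_eq_iff)
  then obtain n :: int where "2 * pi * circle_coord z = 2 * pi * circle_coord w + 2 * pi * of_int n"
    using sin_cos_eq_iff by blast
  then have "2 * pi * circle_coord z = 2 * pi * (circle_coord w + of_int n)" 
    by (simp add: algebra_simps)
  then have "circle_coord z = circle_coord w + of_int n" by simp
  then show "z = w" by (metis circle_proj_coord circle_proj_add_int)
qed

lemma compact_circle: "compact (UNIV :: circle set)"
proof -
  have "(UNIV :: circle set) = circle_proj ` {0..1}"
  proof -
    have "z \<in> circle_proj ` {0..1}" for z
      using imageI[of "circle_coord z" "{0..1}" circle_proj] circle_coord_bounds[of z] by simp
    then show ?thesis by auto
  qed
  then show ?thesis
    by (metis compact_continuous_image continuous_circle_proj continuous_on_subset compact_Icc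
        subset_UNIV)
qed

lemma compact_circle_iff_closed: "compact (K :: circle set) \<longleftrightarrow> closed K"
proof
  assume "compact K"
  then have "compact (circle_embed ` K)"
    by (intro compact_continuous_image continuous_on_subset[OF continuous_circle_embed]) auto
  then have "closed (circle_embed -` (circle_embed ` K))"
    by (intro closed_vimage compact_imp_closed continuous_circle_embed)
  then show "closed K" by (simp add: inj_vimage_image_eq[OF inj_circle_embed])
next
  assume "closed K"
  then show "compact K" using compact_Int_closed[OF compact_circle] by simp
qed

text \<open>Local compactness, in the form that continuity of composition in the compact-open
  topology requires. With \<open>d\<close> a lower bound for the distance in the plane between the
  images of \<open>C\<close> and of the complement of \<open>W\<close>, the sets of points at
  distance below, or at most, \<open>d/2\<close> from the image of \<open>C\<close> serve as
  \<open>V\<close> and \<open>L\<close>.\<close>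

lemma circle_compact_neighbourhood:
  fixes C W :: "circle set"
  assumes "compact C" "open W" "C \<subseteq> W"
  obtains V L where "open V" "compact L" "C \<subseteq> V" "V \<subseteq> L" "L \<subseteq> W"
\<comment> \<open>\<open>infdist\<close> to the empty set is 0 by convention, so the sublevel sets
  used below would be the whole circle.\<close>
proof (cases "C = {}")
  case True
  then show ?thesis using that[of "{}" "{}"] by auto
next
  case ne: False
  have comp: "compact (circle_embed ` A)" if "compact A" for A
    using that by (intro compact_continuous_image continuous_on_subset[OF continuous_circle_embed]) auto
  have "compact (- W)" using assms by (simp add: compact_circle_iff_closed closed_Compl)
  then have "closed (circle_embed ` (- W))" by (intro compact_imp_closed comp)
  moreover have "circle_embed ` C \<inter> circle_embed ` (- W) = {}"
    using assms(3) inj_circle_embed by (auto dest: injD)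
  ultimately obtain d where d: "d > 0"
    "\<And>x y. x \<in> circle_embed ` C \<Longrightarrow> y \<in> circle_embed ` (- W) \<Longrightarrow> d \<le> dist x y"
    using separate_compact_closed[OF comp[OF assms(1)]] by metis
  define D where "D z = infdist (circle_embed z) (circle_embed ` C)" for z
  have D: "continuous_on UNIV D"
    unfolding D_def by (intro continuous_intros continuous_circle_embed)
  show ?thesis
  proof (rule that)
    have "open (D -` {..<d/2})" "closed (D -` {..d/2})"
      using D by (auto intro: open_vimage closed_vimage)
    then show "open (D -` {..<d/2})" "compact (D -` {..d/2})"
      by (simp_all add: compact_circle_iff_closed)
    show "C \<subseteq> D -` {..<d/2}" using d by (auto simp: D_def)
    show "D -` {..<d/2} \<subseteq> D -` {..d/2}" by auto
    show "D -` {..d/2} \<subseteq> W"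
    proof (rule subsetI, rule ccontr)
      fix z assume z: "z \<in> D -` {..d/2}" "z \<notin> W"
      have "d \<le> D z" unfolding D_def using z ne d(2)
        by (subst infdist_notempty) (auto intro!: cINF_greatest simp: dist_commute)
      then show False using z d by auto
    qed
  qed
qed

section \<open>Lifts and the Euler cocycle\<close>

text \<open>On [x, y] the lift \<open>G\<close> stands still, so \<open>f\<close> is constant there.
  At \<open>y\<close> the lift \<open>F\<close> has already made its full turn, so it stands still
  from \<open>y\<close> to x + 1. Together these ranges meet a lift of every point.\<close>

lemma lifts_const_of_jump:
  assumes F: "mono F" "\<And>x. F (x + 1) = F x + 1" "is_lift F f"
    and G: "mono G" "is_lift G f"
    and "x \<le> y" "G y = G x" "F y = F x + 1"
  shows "f z = f (circle_proj x)"
proof -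
  obtain t where t: "x \<le> t" "t < x + 1" "circle_proj t = z"
    by (rule circle_proj_lift_ge)
  show ?thesis
  proof (cases "t \<le> y")
    case True
    then have "G t = G x" using monoD[OF G(1) t(1)] monoD[OF G(1) True] assms by simp
    then show ?thesis using G(2) t(3) by (metis is_lift_def)
  next
    case False
    then have "F t = F x + 1"
      using monoD[OF F(1), of y t] monoD[OF F(1), of t "x + 1"] t assms by simp
    then show ?thesis using F(3) t(3) circle_proj_add_int[of "F x" 1]
      by (metis is_lift_def of_int_1)
  qed
qed

text \<open>The difference of two lifts takes integer values. If it changed within a period, it
  would change by at least 1, which forces one lift to make a full turn while the other stands
  still; \<open>lifts_const_of_jump\<close> excludes this for a map with two values.\<close>

lemma lifts_diff_const:
  assumes F: "mono F" "\<And>x. F (x + 1) = F x + 1" "is_lift F f"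
    and G: "mono G" "\<And>x. G (x + 1) = G x + 1" "is_lift G f"
    and nc: "f u \<noteq> f v"
  shows "\<exists>n::int. \<forall>x. F x = G x + of_int n"
proof -
  define D where "D x = F x - G x" for x
  have per: "D (frac x) = D x" for x
    using degree_one_frac[of F x, OF F(2)] degree_one_frac[of G x, OF G(2)] by (simp add: D_def)
  have Dint: "D x \<in> \<int>" for x
    using F(3) G(3) by (auto simp: D_def is_lift_def circle_proj_eq_iff[symmetric])
  \<comment> \<open>Stated for a generic pair of lifts so that it applies again with
    \<open>F\<close> and \<open>G\<close> exchanged.\<close>
  have key: "D' x \<ge> D' y" if "mono F'" "mono G'" "is_lift F' f" "is_lift G' f"
    "\<And>x. F' (x + 1) = F' x + 1" "\<And>x. G' (x + 1) = G' x + 1"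
    "x \<le> y" "y < x + 1" "D' x - D' y \<in> \<int>" "\<And>x. D' x = F' x - G' x" for F' G' D' x y
  proof (rule ccontr)
    assume "\<not> D' x \<ge> D' y"
    moreover obtain k where k: "D' x - D' y = of_int k" using \<open>D' x - D' y \<in> \<int>\<close> by (auto elim: Ints_cases)
    ultimately have "of_int k < (0::real)" by linarith
    then have "k \<le> - 1" by simp
    then have "D' x - D' y \<le> - 1" unfolding k by linarith
    moreover have "F' y \<le> F' x + 1" using monoD[OF that(1), of y "x+1"] that by simp
    moreover have "G' x \<le> G' y" using monoD[OF that(2), of x y] that by simp
    ultimately have "F' y = F' x + 1" "G' y = G' x" using that(10) by force+
    then have "\<And>z. f z = f (circle_proj x)"
      using lifts_const_of_jump[of F' f G' x y] that by blast
    then show False using nc by metis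
  qed
  have eq: "D x = D y" if "x \<le> y" "y < x + 1" for x y
  proof (rule antisym)
    show "D y \<le> D x" using key[of F G x y D] F G that Dint by (simp add: D_def)
    have "- D y \<le> - D x"
      using key[of G F x y "\<lambda>x. - D x"] F G that Ints_diff[OF Dint[of y] Dint[of x]]
      by (simp add: D_def algebra_simps)
    then show "D x \<le> D y" by simp
  qed
  have "D x = D 0" for x using eq[of 0 "frac x"] per[of x] frac_lt_1[of x] by simp
  moreover obtain n where "D 0 = of_int n" using Dint[of 0] by (auto elim: Ints_cases)
  ultimately show ?thesis by (intro exI[of _ n]) (metis D_def add.commute diff_add_cancel)
qed

section \<open>The groups of homeomorphisms of the line and of the circle\<close>

lemma homeo_lineD:
  assumes "F \<in> homeo_line"
  shows "mono F" "strict_mono F" "F (x + 1) = F x + 1" "continuous_on UNIV F"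
proof -
  show sm: "strict_mono F" and "F (x + 1) = F x + 1" using assms by (auto simp: homeo_line_def)
  show "mono F" using sm by (rule strict_mono_mono)
  obtain F' where F': "homeomorphism UNIV UNIV F F'" using assms by (auto simp: homeo_line_def)
  show "continuous_on UNIV F" using F' by (rule homeomorphism_cont1)
qed

lemma homeo_line_comp: "F \<in> homeo_line \<Longrightarrow> G \<in> homeo_line \<Longrightarrow> F \<circ> G \<in> homeo_line"
  unfolding homeo_line_def by (auto intro: homeomorphism_compose strict_mono_compose[unfolded comp_def[symmetric]] simp: strict_mono_def)

lemma homeo_line_translation: "(\<lambda>x. x + c) \<in> homeo_line"
proof -
  have "homeomorphism UNIV UNIV (\<lambda>x::real. x + c) (\<lambda>x. x - c)"
    by (auto intro!: homeomorphismI continuous_intros)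
  then show ?thesis by (auto simp: homeo_line_def strict_mono_def)
qed

lemma is_lift_comp: "is_lift F f \<Longrightarrow> is_lift G g \<Longrightarrow> is_lift (F \<circ> G) (f \<circ> g)"
  by (simp add: is_lift_def)

lemma is_lift_comp_translation: "is_lift F f \<Longrightarrow> is_lift (\<lambda>x. F x + of_int n) f"
  by (simp add: is_lift_def)

lemma homeo_circleD:
  assumes "f \<in> carrier homeo_circle"
  shows "continuous_on UNIV f" "bij f"
  using assms by (auto simp: homeo_circle_def homeomorphism_def bij_def inj_def) metis

lemma homeo_circle_one: "id \<in> carrier homeo_circle"
proof -
  have "is_lift (\<lambda>x. x + 0) id" by (simp add: is_lift_def)
  moreover have "homeomorphism UNIV UNIV (id :: circle \<Rightarrow> circle) id"
    by (auto intro!: homeomorphismI)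
  ultimately show ?thesis
    using homeo_line_translation[of 0] by (auto simp: homeo_circle_def)
qed

lemma homeo_circle_comp:
  assumes "f \<in> carrier homeo_circle" "g \<in> carrier homeo_circle"
  shows "f \<circ> g \<in> carrier homeo_circle"
  using assms by (auto simp: homeo_circle_def intro: homeomorphism_compose)
     (meson homeo_line_comp is_lift_comp)

lemma homeo_circle_inverse:
  assumes "f \<in> carrier homeo_circle"
  obtains g where "g \<in> carrier homeo_circle" "g \<circ> f = id" "f \<circ> g = id"
proof -
  obtain F f' where F: "F \<in> homeo_line" "is_lift F f" and f': "homeomorphism UNIV UNIV f f'"
    using assms by (auto simp: homeo_circle_def)
  obtain F' where F': "homeomorphism UNIV UNIV F F'" using F by (auto simp: homeo_line_def)
  have FF': "F (F' x) = x" "F' (F x) = x" for x using F' by (auto simp: homeomorphism_def)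
  have ff': "f (f' x) = x" "f' (f x) = x" for x using f' by (auto simp: homeomorphism_def)
  have "F' \<in> homeo_line"
    unfolding homeo_line_def
  proof (intro CollectI conjI allI)
    show "\<exists>F. homeomorphism UNIV UNIV F' F" using F' homeomorphism_symD by blast
    show "strict_mono F'"
      by (rule strict_monoI) (metis FF'(1) homeo_lineD(2)[OF F(1)] strict_mono_less)
    show "F' (x + 1) = F' x + 1" for x
      by (metis FF' homeo_lineD(3)[OF F(1)])
  qed
  moreover have "is_lift F' f'"
    using F(2) by (metis is_lift_def FF'(1) ff'(2))
  moreover have "homeomorphism UNIV UNIV f' f" using f' homeomorphism_symD by blast
  ultimately have "f' \<in> carrier homeo_circle" by (auto simp: homeo_circle_def)
  then show ?thesis using that[of f'] ff' by (auto simp: fun_eq_iff)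
qed

lemma group_homeo_circle: "group homeo_circle"
proof (rule groupI)
  fix f assume "f \<in> carrier homeo_circle"
  then show "\<exists>g\<in>carrier homeo_circle. g \<otimes>\<^bsub>homeo_circle\<^esub> f = \<one>\<^bsub>homeo_circle\<^esub>"
    by (rule homeo_circle_inverse) (auto simp: homeo_circle_def)
qed (use homeo_circle_comp homeo_circle_one in \<open>auto simp: homeo_circle_def comp_assoc\<close>)

lemma homeo_circle_mult: "f \<otimes>\<^bsub>homeo_circle\<^esub> g = f \<circ> g"
  by (simp add: homeo_circle_def)

lemma homeo_circle_inv:
  assumes "f \<in> carrier homeo_circle"
  shows "inv\<^bsub>homeo_circle\<^esub> f \<in> carrier homeo_circle"
    "f ((inv\<^bsub>homeo_circle\<^esub> f) x) = x" "(inv\<^bsub>homeo_circle\<^esub> f) (f x) = x"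
proof -
  interpret group homeo_circle by (rule group_homeo_circle)
  show "inv\<^bsub>homeo_circle\<^esub> f \<in> carrier homeo_circle" using assms by simp
  have "f \<circ> inv\<^bsub>homeo_circle\<^esub> f = id" "inv\<^bsub>homeo_circle\<^esub> f \<circ> f = id"
    using r_inv[OF assms] l_inv[OF assms] by (simp_all add: homeo_circle_def)
  then show "f ((inv\<^bsub>homeo_circle\<^esub> f) x) = x" "(inv\<^bsub>homeo_circle\<^esub> f) (f x) = x"
    by (metis comp_apply id_apply)+
qed

lemma homeo_line_lifts_diff:
  assumes "f \<in> carrier homeo_circle" "F \<in> homeo_line" "is_lift F f" "G \<in> homeo_line" "is_lift G f"
  shows "\<exists>n::int. \<forall>x. F x = G x + of_int n"
proof -
  have "circle_proj 0 \<noteq> circle_proj (1/2)"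
  proof
    assume "circle_proj 0 = circle_proj (1/2)"
    then have "frac (0::real) = frac (1/2)" by (metis circle_coord_proj)
    then show False by (simp add: frac_eq[THEN iffD2])
  qed
  then have "f (circle_proj 0) \<noteq> f (circle_proj (1/2))"
    using homeo_circleD(2)[OF assms(1)] by (metis bij_def injD)
  then show ?thesis
    using lifts_diff_const[of F f G] homeo_lineD[OF assms(2)] homeo_lineD[OF assms(4)] assms by blast
qed

section \<open>The normalised section and the Euler cocycle\<close>

lemma lift_section:
  assumes "f \<in> carrier homeo_circle"
  shows "lift_section f \<in> homeo_line" "is_lift (lift_section f) f"
    "0 \<le> lift_section f 0" "lift_section f 0 < 1"
proof -
  obtain F where F: "F \<in> homeo_line" "is_lift F f"
    using assms by (auto simp: homeo_circle_def)
  have ex: "\<exists>!F. F \<in> homeo_line \<and> is_lift F f \<and> F 0 \<in> {0..<1}"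
  proof (rule ex_ex1I)
    let ?F = "\<lambda>x. F x + of_int (- \<lfloor>F 0\<rfloor>)"
    have "?F \<in> homeo_line"
      using homeo_line_comp[OF homeo_line_translation[of "of_int (- \<lfloor>F 0\<rfloor>)"] F(1)] by (simp add: comp_def)
    moreover have "is_lift ?F f" using F(2) by (rule is_lift_comp_translation)
    moreover have "?F 0 \<in> {0..<1}" by (simp, linarith)
    ultimately show "\<exists>F. F \<in> homeo_line \<and> is_lift F f \<and> F 0 \<in> {0..<1}" by blast
  next
    fix F G assume F: "F \<in> homeo_line \<and> is_lift F f \<and> F 0 \<in> {0..<1}"
      and G: "G \<in> homeo_line \<and> is_lift G f \<and> G 0 \<in> {0..<1}"
    then obtain n :: int where n: "\<And>x. F x = G x + of_int n"
      using homeo_line_lifts_diff[OF assms, of F G] by auto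
    have "of_int n < (1::real)" "(-1::real) < of_int n" using n[of 0] F G by auto
    then have "n = 0" by linarith
    then show "F = G" using n by auto
  qed
  have "lift_section f \<in> homeo_line \<and> is_lift (lift_section f) f \<and> lift_section f 0 \<in> {0..<1}"
    unfolding lift_section_def by (rule theI'[OF ex])
  then show "lift_section f \<in> homeo_line" "is_lift (lift_section f) f"
    "0 \<le> lift_section f 0" "lift_section f 0 < 1" by auto
qed

lemmas lift_section_mono = homeo_lineD(1)[OF lift_section(1)]
  and lift_section_strict_mono = homeo_lineD(2)[OF lift_section(1)]
  and lift_section_add_one = homeo_lineD(3)[OF lift_section(1)]
  and lift_section_continuous = homeo_lineD(4)[OF lift_section(1)]

lemma circle_proj_lift_section:
  "f \<in> carrier homeo_circle \<Longrightarrow> circle_proj (lift_section f x) = f (circle_proj x)"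
  using lift_section(2) by (auto simp: is_lift_def)

text \<open>The identity at every \<open>x\<close> serves for algebra. At 0 the section of the
  product lies in [0, 1), so the integer is a floor; this form makes the cocycle visibly Borel and
  bounded.\<close>

lemma euler_cocycle:
  assumes f: "f \<in> carrier homeo_circle" and g: "g \<in> carrier homeo_circle"
  shows "lift_section f (lift_section g x) = lift_section (f \<circ> g) x + of_int (euler_cocycle f g)"
    "euler_cocycle f g = \<lfloor>lift_section f (lift_section g 0)\<rfloor>"
proof -
  have fg: "f \<circ> g \<in> carrier homeo_circle" using f g by (rule homeo_circle_comp)
  obtain n :: int where n: "\<And>x. (lift_section f \<circ> lift_section g) x = lift_section (f \<circ> g) x + of_int n"
    using homeo_line_lifts_diff[OF fg homeo_line_comp[OF lift_section(1)[OF f] lift_section(1)[OF g]]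
      is_lift_comp[OF lift_section(2)[OF f] lift_section(2)[OF g]]
      lift_section(1,2)[OF fg]] by blast
  have tr: "lift_section (f \<circ> g) (x + of_int k) = lift_section (f \<circ> g) x + of_int k" for x k
    using degree_one_int[of "lift_section (f \<circ> g)"] lift_section_add_one[OF fg] by blast
  have "euler_cocycle f g = n"
    unfolding euler_cocycle_def
  proof (rule the_equality)
    show "lift_section (f \<circ> g) \<circ> translation n = lift_section f \<circ> lift_section g"
      using n by (auto simp: translation_def tr)
  next
    fix m assume "lift_section (f \<circ> g) \<circ> translation m = lift_section f \<circ> lift_section g"
    then have "lift_section (f \<circ> g) (translation m 0) = lift_section f (lift_section g 0)"
      by (metis comp_apply)
    then show "m = n" using n[of 0] tr[of 0 m] by (simp add: translation_def)
  qed
  then show "lift_section f (lift_section g x) = lift_section (f \<circ> g) x + of_int (euler_cocycle f g)"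
    using n by simp
  have "lift_section f (lift_section g 0) = lift_section (f \<circ> g) 0 + of_int n" using n[of 0] by simp
  then have "\<lfloor>lift_section f (lift_section g 0)\<rfloor> = n"
    using lift_section(3,4)[OF fg] by linarith
  then show "euler_cocycle f g = \<lfloor>lift_section f (lift_section g 0)\<rfloor>"
    using \<open>euler_cocycle f g = n\<close> by simp
qed

lemma euler_cocycle_bounds:
  assumes f: "f \<in> carrier homeo_circle" and g: "g \<in> carrier homeo_circle"
  shows "\<bar>euler_cocycle f g\<bar> \<le> 1"
proof -
  have "lift_section f 0 \<le> lift_section f (lift_section g 0)"
    "lift_section f (lift_section g 0) \<le> lift_section f (0 + 1)"
    using lift_section(3,4)[OF g] by (intro monoD[OF lift_section_mono[OF f]]; simp)+
  then have "0 \<le> lift_section f (lift_section g 0)" "lift_section f (lift_section g 0) < 2"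
    using lift_section(3,4)[OF f] lift_section_add_one[OF f, of 0] by simp_all
  then show ?thesis unfolding euler_cocycle(2)[OF f g] by linarith
qed

text \<open>Replaces the definite description by an expression in two values of \<open>f\<close>,
  which makes measurability in \<open>f\<close> accessible. A strictly monotone lift gains less than
  1 from 0 to \<open>frac x\<close>, so \<open>frac\<close> recovers the gain from the
  coordinates.\<close>

lemma lift_section_eq:
  assumes "f \<in> carrier homeo_circle"
  shows "lift_section f x = circle_coord (f (circle_proj 0)) + of_int \<lfloor>x\<rfloor>
    + frac (circle_coord (f (circle_proj x)) - circle_coord (f (circle_proj 0)))"
proof -
  let ?S = "lift_section f"
  have 0: "circle_coord (f (circle_proj 0)) = ?S 0"
    using circle_coord_proj[of "?S 0"] lift_section(3,4)[OF assms] 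
    by (simp add: circle_proj_lift_section[OF assms] frac_eq)
  have x: "circle_coord (f (circle_proj x)) = frac (?S (frac x))"
    using circle_coord_proj[of "?S (frac x)"] by (simp add: circle_proj_lift_section[OF assms])
  have "?S 0 \<le> ?S (frac x)" using monoD[OF lift_section_mono[OF assms]] by simp
  moreover have "?S (frac x) < ?S (0 + 1)"
    by (rule strict_monoD[OF lift_section_strict_mono[OF assms]]) (simp add: frac_lt_1)
  ultimately have "0 \<le> ?S (frac x) - ?S 0" "?S (frac x) - ?S 0 < 1"
    using lift_section_add_one[OF assms, of 0] by simp_all
  then have "frac (frac (?S (frac x)) - ?S 0) = ?S (frac x) - ?S 0"
    by (simp add: frac_unique_iff) (simp add: frac_def)
  moreover have "?S x = ?S (frac x) + of_int \<lfloor>x\<rfloor>"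
    using degree_one_frac[of ?S] lift_section_add_one[OF assms] by blast
  ultimately show ?thesis unfolding 0 x by simp
qed

section \<open>The Borel structure of the homeomorphism group\<close>

abbreviation homeo_circle_topology :: "(circle \<Rightarrow> circle) topology"
  where "homeo_circle_topology \<equiv> subtopology compact_open_topology (carrier homeo_circle)"

lemma openin_compact_open: "compact K \<Longrightarrow> open U \<Longrightarrow> openin compact_open_topology {f. f ` K \<subseteq> U}"
  unfolding compact_open_topology_def openin_topology_generated_by_iff
  by (rule generate_topology_on.Basis) blast

lemma topspace_compact_open [simp]: "topspace compact_open_topology = UNIV"
  using openin_subset[OF openin_compact_open[of "{}" "{}"]] by auto

lemma openin_homeo_circle_topology:
  "compact K \<Longrightarrow> open U \<Longrightarrow>
    openin homeo_circle_topology {f \<in> carrier homeo_circle. f ` K \<subseteq> U}"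
  using openin_compact_open[of K U] by (auto simp: openin_subtopology)

lemma space_borel_homeo_circle [simp]: "space borel_homeo_circle = carrier homeo_circle"
  unfolding borel_homeo_circle_def by (rule space_measure_of) (use openin_subset in fastforce)

lemma sets_borel_homeo_circle:
  "sets borel_homeo_circle = sigma_sets (carrier homeo_circle) {V. openin homeo_circle_topology V}"
  unfolding borel_homeo_circle_def by (rule sets_measure_of) (use openin_subset in fastforce)

lemma openin_borel_homeo_circle: "openin homeo_circle_topology V \<Longrightarrow> V \<in> sets borel_homeo_circle"
  by (auto simp: sets_borel_homeo_circle)

lemma continuous_map_homeo_circleI:
  assumes "\<And>x. x \<in> topspace X \<Longrightarrow> g x \<in> carrier homeo_circle"
    and "\<And>K U. compact K \<Longrightarrow> open U \<Longrightarrow> openin X {x \<in> topspace X. g x ` K \<subseteq> U}"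
  shows "continuous_map X homeo_circle_topology g"
proof -
  have "continuous_map X compact_open_topology g"
    unfolding compact_open_topology_def
  proof (rule continuous_on_generated_topo)
    show "g ` topspace X \<subseteq> \<Union> {{f. f ` K \<subseteq> U} |K U. compact K \<and> open U}"
      by (rule subset_trans[OF subset_UNIV]) (rule Sup_upper, blast intro: compact_empty open_empty)
  qed (use assms(2) in \<open>auto simp: vimage_def Int_def conj_commute\<close>)
  then show ?thesis using assms(1) by (auto simp: continuous_map_in_subtopology)
qed

lemma continuous_map_imp_borel_homeo_circle:
  assumes "continuous_map homeo_circle_topology homeo_circle_topology g"
  shows "g \<in> borel_homeo_circle \<rightarrow>\<^sub>M borel_homeo_circle"
  unfolding borel_homeo_circle_def[of]
proof (rule measurable_measure_of)
  show "{V. openin homeo_circle_topology V} \<subseteq> Pow (carrier homeo_circle)"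
    using openin_subset by fastforce
  fix V assume "V \<in> {V. openin homeo_circle_topology V}"
  then have "openin homeo_circle_topology {f \<in> carrier homeo_circle. g f \<in> V}"
    using openin_continuous_map_preimage[OF assms, of V] by simp
  then show "g -` V \<inter> space (sigma (carrier homeo_circle) {V. openin homeo_circle_topology V})
    \<in> sets (sigma (carrier homeo_circle) {V. openin homeo_circle_topology V})"
    using openin_borel_homeo_circle space_borel_homeo_circle
    by (simp add: borel_homeo_circle_def vimage_def Int_def conj_commute)
qed (use assms space_borel_homeo_circle in \<open>auto simp: continuous_map_def borel_homeo_circle_def\<close>)

lemma continuous_map_comp_homeo_circle:
  assumes p: "continuous_map X homeo_circle_topology p" and q: "continuous_map X homeo_circle_topology q"
  shows "continuous_map X homeo_circle_topology (\<lambda>x. p x \<circ> q x)"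
proof (rule continuous_map_homeo_circleI)
  have car: "p x \<in> carrier homeo_circle" "q x \<in> carrier homeo_circle" if "x \<in> topspace X" for x
    using p q that by (auto simp: continuous_map_def)
  then show "p x \<circ> q x \<in> carrier homeo_circle" if "x \<in> topspace X" for x
    using homeo_circle_comp that by blast
  fix K U :: "circle set" assume K: "compact K" and U: "open U"
  show "openin X {x \<in> topspace X. (p x \<circ> q x) ` K \<subseteq> U}"
  proof (subst openin_subopen, intro ballI)
    fix x assume x: "x \<in> {x \<in> topspace X. (p x \<circ> q x) ` K \<subseteq> U}"
    have "compact (q x ` K)"
      using K x car homeo_circleD(1)
      by (intro compact_continuous_image) (auto intro: continuous_on_subset)
    moreover have "open (p x -` U)" using U x car homeo_circleD(1) by (auto intro: open_vimage)
    moreover have "q x ` K \<subseteq> p x -` U" using x by auto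
    ultimately obtain V L where VL: "open V" "compact L" "q x ` K \<subseteq> V" "V \<subseteq> L" "L \<subseteq> p x -` U"
      by (rule circle_compact_neighbourhood)
    \<comment> \<open>\<open>q y\<close> has to map \<open>K\<close> into the open set
      \<open>V\<close>, and \<open>p y\<close> has to map the compact set \<open>L\<close> into
      \<open>U\<close>; both conditions are open, and they compose because \<open>V\<close> is
      contained in \<open>L\<close>.\<close>
    let ?T = "{y \<in> topspace X. p y \<in> {f \<in> carrier homeo_circle. f ` L \<subseteq> U}} \<inter>
      {y \<in> topspace X. q y \<in> {f \<in> carrier homeo_circle. f ` K \<subseteq> V}}"
    have "openin X ?T"
      using VL K U openin_homeo_circle_topology
      by (intro openin_Int openin_continuous_map_preimage[OF p] openin_continuous_map_preimage[OF q]) auto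
    moreover have "x \<in> ?T" using x VL car by auto
    moreover have "?T \<subseteq> {x \<in> topspace X. (p x \<circ> q x) ` K \<subseteq> U}" using VL(4) by fastforce
    ultimately show "\<exists>T. openin X T \<and> x \<in> T \<and> T \<subseteq> {x \<in> topspace X. (p x \<circ> q x) ` K \<subseteq> U}"
      by (intro exI[of _ ?T] conjI)
  qed
qed

text \<open>Obtained from continuity of composition along a single space, so that the Borel
  structure of a product topology need not be compared with the product of Borel structures.\<close>

lemma measurable_homeo_circle_funpow:
  "(\<lambda>f. f ^^ n) \<in> borel_homeo_circle \<rightarrow>\<^sub>M borel_homeo_circle"
proof (rule continuous_map_imp_borel_homeo_circle, induction n)
  case 0
  have "continuous_map homeo_circle_topology homeo_circle_topology (\<lambda>f. id)"
    using homeo_circle_one by simp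
  then show ?case by (simp add: id_def[symmetric] funpow.simps(1)[abs_def])
next
  case (Suc n)
  have "continuous_map homeo_circle_topology homeo_circle_topology (\<lambda>f. f)" by simp
  from continuous_map_comp_homeo_circle[OF this Suc] show ?case by (simp only: funpow.simps)
qed

text \<open>Complements turn the condition that the inverse of \<open>f\<close> maps
  \<open>K\<close> into \<open>U\<close> into the condition that \<open>f\<close> maps
  \<open>- U\<close> into \<open>- K\<close>. On the circle closed and compact agree, so this is
  again a subbasic open condition.\<close>

lemma measurable_homeo_circle_inv:
  "m_inv homeo_circle \<in> borel_homeo_circle \<rightarrow>\<^sub>M borel_homeo_circle"
proof (intro continuous_map_imp_borel_homeo_circle continuous_map_homeo_circleI)
  show "inv\<^bsub>homeo_circle\<^esub> f \<in> carrier homeo_circle" if "f \<in> topspace homeo_circle_topology" for f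
    using that homeo_circle_inv(1) by simp
  fix K U :: "circle set" assume K: "compact K" and U: "open U"
  have *: "(inv\<^bsub>homeo_circle\<^esub> f) ` K \<subseteq> U \<longleftrightarrow> f ` (- U) \<subseteq> - K" if "f \<in> carrier homeo_circle" for f
    using homeo_circle_inv(2,3)[OF that] by (auto simp: subset_iff image_iff)
  have "compact (- U)" "open (- K)"
    using K U by (auto simp: compact_circle_iff_closed)
  then have "openin homeo_circle_topology {f \<in> carrier homeo_circle. f ` (- U) \<subseteq> - K}"
    by (rule openin_homeo_circle_topology)
  also have "{f \<in> carrier homeo_circle. f ` (- U) \<subseteq> - K} =
    {f \<in> topspace homeo_circle_topology. (inv\<^bsub>homeo_circle\<^esub> f) ` K \<subseteq> U}"
    using * by auto
  finally show "openin homeo_circle_topology \<dots>" .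
qed

lemma measurable_homeo_circle_eval: "(\<lambda>f. f z) \<in> borel_homeo_circle \<rightarrow>\<^sub>M borel"
proof (rule borel_measurableI)
  fix U :: "circle set" assume "open U"
  then have "{f \<in> carrier homeo_circle. f ` {z} \<subseteq> U} \<in> sets borel_homeo_circle"
    by (intro openin_borel_homeo_circle openin_homeo_circle_topology) auto
  then show "(\<lambda>f. f z) -` U \<inter> space borel_homeo_circle \<in> sets borel_homeo_circle"
    by (simp add: vimage_def Int_def conj_commute)
qed

section \<open>Measurability of lifts and of the Euler cocycle\<close>

lemma measurable_frac [measurable]: "(frac :: real \<Rightarrow> real) \<in> borel \<rightarrow>\<^sub>M borel"
  unfolding frac_def by measurable

lemma measurable_lift_section_at: "(\<lambda>f. lift_section f x) \<in> borel_homeo_circle \<rightarrow>\<^sub>M borel"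
proof (subst measurable_cong[OF lift_section_eq])
  note [measurable] = measurable_homeo_circle_eval
  show "(\<lambda>f. circle_coord (f (circle_proj 0)) + of_int \<lfloor>x\<rfloor>
    + frac (circle_coord (f (circle_proj x)) - circle_coord (f (circle_proj 0))))
    \<in> borel_homeo_circle \<rightarrow>\<^sub>M borel"
    by measurable
qed simp

text \<open>Continuity yields a rational witness to the right of \<open>x\<close>, monotonicity
  gives the converse. Evaluation at a point that varies with the parameter thus reduces to countably
  many evaluations at fixed points.\<close>

lemma lift_section_less_iff:
  assumes "f \<in> carrier homeo_circle"
  shows "lift_section f x < c \<longleftrightarrow> (\<exists>q::rat. x < of_rat q \<and> lift_section f (of_rat q) < c)"
proof
  assume less: "lift_section f x < c"
  have "isCont (lift_section f) x"
    using lift_section_continuous[OF assms] by (simp add: continuous_on_eq_continuous_at)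
  then have "eventually (\<lambda>y. lift_section f y < c) (at x)"
    using less by (auto simp: isCont_def dest: order_tendstoD(2))
  then obtain d where d: "d > 0" "\<And>y. y \<noteq> x \<Longrightarrow> dist y x < d \<Longrightarrow> lift_section f y < c"
    by (auto simp: eventually_at)
  obtain q where "x < of_rat q" "of_rat q < x + d"
    using of_rat_dense[of x "x + d"] d(1) by auto
  then show "\<exists>q::rat. x < of_rat q \<and> lift_section f (of_rat q) < c"
    using d(2)[of "of_rat q"] by (auto simp: dist_real_def)
next
  assume "\<exists>q::rat. x < of_rat q \<and> lift_section f (of_rat q) < c"
  then obtain q :: rat where "x < of_rat q" "lift_section f (of_rat q) < c" by blast
  then show "lift_section f x < c"
    using monoD[OF lift_section_mono[OF assms], of x "of_rat q"] by simp
qed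

lemma measurable_lift_section_comp [measurable (raw)]:
  assumes p: "p \<in> M \<rightarrow>\<^sub>M borel_homeo_circle" and X: "X \<in> M \<rightarrow>\<^sub>M (borel :: real measure)"
  shows "(\<lambda>w. lift_section (p w) (X w)) \<in> M \<rightarrow>\<^sub>M borel"
proof (rule borel_measurableI_less)
  fix c
  note [measurable] = X measurable_compose[OF p measurable_lift_section_at]
  have "{w \<in> space M. lift_section (p w) (X w) < c} =
    {w \<in> space M. \<exists>q::rat. X w < of_rat q \<and> lift_section (p w) (of_rat q) < c}"
    using measurable_space[OF p] by (intro Collect_cong conj_cong refl lift_section_less_iff) simp
  also have "\<dots> \<in> sets M" by measurable
  finally show "{w \<in> space M. lift_section (p w) (X w) < c} \<in> sets M" .
qed

lemma measurable_euler_cocycle [measurable (raw)]: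
  assumes p: "p \<in> M \<rightarrow>\<^sub>M borel_homeo_circle" and q: "q \<in> M \<rightarrow>\<^sub>M borel_homeo_circle"
  shows "(\<lambda>w. euler_cocycle (p w) (q w)) \<in> M \<rightarrow>\<^sub>M count_space UNIV"
proof (subst measurable_cong)
  show "euler_cocycle (p w) (q w) = \<lfloor>lift_section (p w) (lift_section (q w) 0)\<rfloor>" if "w \<in> space M" for w
    using that measurable_space[OF p] measurable_space[OF q] by (intro euler_cocycle(2)) auto
  note [measurable] = p q
  show "(\<lambda>w. \<lfloor>lift_section (p w) (lift_section (q w) 0)\<rfloor>) \<in> M \<rightarrow>\<^sub>M count_space UNIV"
    by measurable
qed

lemma funpow_homeo_circle: "f \<in> carrier homeo_circle \<Longrightarrow> f ^^ n \<in> carrier homeo_circle"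
  using measurable_space[OF measurable_homeo_circle_funpow] by simp

text \<open>Summing \<open>\<delta>\<beta>(f\<^sup>k, f)\<close> over \<open>k\<close> telescopes, so that a bounded \<open>\<beta>\<close> is the limit of the averages
  of its coboundary.\<close>

lemma measurable_of_coboundary:
  fixes \<beta> :: "(circle \<Rightarrow> circle) \<Rightarrow> int"
  assumes bdd: "\<And>f. f \<in> carrier homeo_circle \<Longrightarrow> \<bar>real_of_int (\<beta> f)\<bar> \<le> C"
    and meas: "(\<lambda>(f, g). \<beta> g - \<beta> (f \<circ> g) + \<beta> f)
      \<in> borel_homeo_circle \<Otimes>\<^sub>M borel_homeo_circle \<rightarrow>\<^sub>M count_space UNIV"
  shows "\<beta> \<in> borel_homeo_circle \<rightarrow>\<^sub>M count_space UNIV"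
proof -
  define d where "d k f = real_of_int (\<beta> f - \<beta> ((f ^^ k) \<circ> f) + \<beta> (f ^^ k))" for k f
  have d_meas: "d k \<in> borel_homeo_circle \<rightarrow>\<^sub>M borel" for k
  proof -
    have "(\<lambda>f. (f ^^ k, f)) \<in> borel_homeo_circle \<rightarrow>\<^sub>M borel_homeo_circle \<Otimes>\<^sub>M borel_homeo_circle"
      using measurable_homeo_circle_funpow by measurable
    from measurable_compose[OF this meas]
    have [measurable]: "(\<lambda>f. \<beta> f - \<beta> ((f ^^ k) \<circ> f) + \<beta> (f ^^ k)) \<in> borel_homeo_circle \<rightarrow>\<^sub>M count_space UNIV"
      by simp
    show ?thesis unfolding d_def by measurable
  qed
  have sum_d: "(\<Sum>k<n. d k f) = real n * \<beta> f + (\<beta> id - \<beta> (f ^^ n))" for n f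
  proof (induction n)
    case (Suc n)
    have "d n f = real_of_int (\<beta> f - \<beta> (f ^^ Suc n) + \<beta> (f ^^ n))"
      unfolding d_def funpow_Suc_right ..
    with Suc show ?case by (simp add: algebra_simps del: funpow.simps)
  qed simp
  have lim: "(\<lambda>n. (\<Sum>k<n. d k f) / real n) \<longlonglongrightarrow> real_of_int (\<beta> f)" if f: "f \<in> carrier homeo_circle" for f
  proof -
    have "(\<lambda>n. (real_of_int (\<beta> id) - \<beta> (f ^^ n)) / real n) \<longlonglongrightarrow> 0"
    proof (rule tendsto_0_le[where K = "2 * C" and f = "\<lambda>n. 1 / real n"])
      show "(\<lambda>n. 1 / real n) \<longlonglongrightarrow> 0" by (rule lim_1_over_n)
      have "\<bar>real_of_int (\<beta> id) - \<beta> (f ^^ n)\<bar> \<le> 2 * C" for n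
        using bdd[OF homeo_circle_one] bdd[OF funpow_homeo_circle[OF f, of n]] by linarith
      then show "\<forall>\<^sub>F n in sequentially. norm ((real_of_int (\<beta> id) - \<beta> (f ^^ n)) / real n)
          \<le> norm (1 / real n) * (2 * C)"
        by (intro always_eventually allI) (simp add: divide_right_mono)
    qed
    from tendsto_add[OF tendsto_const[of "real_of_int (\<beta> f)"] this]
    have "(\<lambda>n. \<beta> f + (real_of_int (\<beta> id) - \<beta> (f ^^ n)) / real n) \<longlonglongrightarrow> real_of_int (\<beta> f)" by simp
    then show ?thesis
    proof (rule Lim_transform_eventually)
      show "\<forall>\<^sub>F n in sequentially. \<beta> f + (real_of_int (\<beta> id) - \<beta> (f ^^ n)) / real n
          = (\<Sum>k<n. d k f) / real n"
        using eventually_gt_at_top[of 0] by eventually_elim (simp add: sum_d field_simps)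
    qed
  qed
  have "(\<lambda>f. real_of_int (\<beta> f)) \<in> borel_homeo_circle \<rightarrow>\<^sub>M borel"
  proof (rule borel_measurable_LIMSEQ_real[OF lim])
    show "(\<lambda>f. (\<Sum>k<n. d k f) / real n) \<in> borel_homeo_circle \<rightarrow>\<^sub>M borel" for n
      using d_meas by measurable
  qed simp
  then have "(\<lambda>f. \<lfloor>real_of_int (\<beta> f)\<rfloor>) \<in> borel_homeo_circle \<rightarrow>\<^sub>M count_space UNIV" by measurable
  then show ?thesis by simp
qed

section \<open>Bounded cohomology in degree two\<close>

lemma tuples_2: "xs \<in> tuples G 2 \<longleftrightarrow> (\<exists>g h. xs = [g, h] \<and> g \<in> carrier G \<and> h \<in> carrier G)"
  by (auto simp: tuples_def numeral_2_eq_2 length_Suc_conv)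

lemma tuples_1: "[g] \<in> tuples G 1 \<longleftrightarrow> g \<in> carrier G"
  by (simp add: tuples_def)

lemma bounded_cochain_1_closed:
  "b \<in> bounded_cochains G A 1 \<Longrightarrow> g \<in> carrier G \<Longrightarrow> b [g] \<in> carrier A"
  using tuples_1 by (fastforce simp: bounded_cochains_def)

lemma coboundary_1:
  assumes "comm_group A" "group G" "f \<in> bounded_cochains G A 1"
    and "g \<in> carrier G" "h \<in> carrier G"
  shows "coboundary G A 1 f [g, h] =
    act A g (f [h]) \<otimes>\<^bsub>A\<^esub> inv\<^bsub>A\<^esub> (f [g \<otimes>\<^bsub>G\<^esub> h]) \<otimes>\<^bsub>A\<^esub> f [g]"
proof -
  interpret A: comm_group A by fact
  interpret G: group G by fact
  note cl = bounded_cochain_1_closed[OF assms(3)]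
  have "f [g \<otimes>\<^bsub>G\<^esub> h] [^]\<^bsub>A\<^esub> (- 1 :: int) = inv\<^bsub>A\<^esub> (f [g \<otimes>\<^bsub>G\<^esub> h])"
    using A.int_pow_neg[of "f [g \<otimes>\<^bsub>G\<^esub> h]" 1] assms(4,5) cl by (simp add: A.int_pow_1)
  moreover have "(\<Otimes>\<^bsub>A\<^esub>i\<in>{1..1}. f (merge_at G i [g, h]) [^]\<^bsub>A\<^esub> ((-1) ^ i :: int))
      = f [g \<otimes>\<^bsub>G\<^esub> h] [^]\<^bsub>A\<^esub> (- 1 :: int)"
    using A.finprod_insert[of "{}" "1::nat" "\<lambda>i. f (merge_at G i [g, h]) [^]\<^bsub>A\<^esub> ((-1) ^ i :: int)"] assms(4,5) cl
    by (simp add: merge_at_def)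
  ultimately show ?thesis
    using assms(4,5) cl by (simp add: coboundary_def tuples_def A.int_pow_1)
qed

lemma bounded_coboundaries_2: "bounded_coboundaries G A 2 = coboundary G A 1 ` bounded_cochains G A 1"
  by (simp add: bounded_coboundaries_def numeral_2_eq_2)

text \<open>A member of the first coset is the coboundary of some \<open>b\<close> plus
  \<open>F1\<close>; moving the coboundary of \<open>h\<close> over makes it the coboundary of
  \<open>b + h\<close> plus \<open>F2\<close>. The triangle inequality keeps \<open>b + h\<close>
  bounded, and the action by homomorphisms makes the coboundary additive. The reverse inclusion
  arises by negating \<open>h\<close>.\<close>

lemma cohomology_class_2_subset:
  assumes A: "comm_group A" and G: "group G"
    and act: "\<And>g. g \<in> carrier G \<Longrightarrow> act A g \<in> hom A A"
    and norm: "\<And>X Y. X \<in> carrier A \<Longrightarrow> Y \<in> carrier A \<Longrightarrow> mnorm A (X \<otimes>\<^bsub>A\<^esub> Y) \<le> mnorm A X + mnorm A Y"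
    and h: "h \<in> bounded_cochains G A 1"
    and F2: "\<And>g k. g \<in> carrier G \<Longrightarrow> k \<in> carrier G \<Longrightarrow> F2 [g, k] \<in> carrier A"
    and F1: "\<And>g k. g \<in> carrier G \<Longrightarrow> k \<in> carrier G \<Longrightarrow>
      F1 [g, k] = coboundary G A 1 h [g, k] \<otimes>\<^bsub>A\<^esub> F2 [g, k]"
  shows "cohomology_class G A 2 F1 \<subseteq> cohomology_class G A 2 F2"
proof
  interpret A: comm_group A by fact
  interpret G: group G by fact
  have cl: "b [g] \<in> carrier A" if "b \<in> bounded_cochains G A 1" "g \<in> carrier G" for b g
    using that by (rule bounded_cochain_1_closed)
  have actcl: "act A g x \<in> carrier A" if "g \<in> carrier G" "x \<in> carrier A" for g x
    using act[OF that(1)] that(2) by (auto simp: hom_def)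
  fix c assume "c \<in> cohomology_class G A 2 F1"
  then obtain b where b: "b \<in> bounded_cochains G A 1"
    and c: "c = (\<lambda>xs\<in>tuples G 2. coboundary G A 1 b xs \<otimes>\<^bsub>A\<^esub> F1 xs)"
    by (auto simp: cohomology_class_def r_coset_def bounded_coboundaries_2 cochain_group_def)
  define b' where "b' = (\<lambda>xs\<in>tuples G 1. b xs \<otimes>\<^bsub>A\<^esub> h xs)"
  have b': "b' \<in> bounded_cochains G A 1"
  proof -
    obtain B where "\<forall>xs\<in>tuples G 1. mnorm A (b xs) \<le> B"
      using b unfolding bounded_cochains_def by blast
    moreover obtain C where "\<forall>xs\<in>tuples G 1. mnorm A (h xs) \<le> C"
      using h unfolding bounded_cochains_def by blast
    ultimately have "mnorm A (b' xs) \<le> B + C" if "xs \<in> tuples G 1" for xs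
      using norm[of "b xs" "h xs"] that b h by (force simp: bounded_cochains_def b'_def)
    then show ?thesis using b h by (auto simp: bounded_cochains_def b'_def)
  qed
  have "coboundary G A 1 b [g, k] \<otimes>\<^bsub>A\<^esub> F1 [g, k] = coboundary G A 1 b' [g, k] \<otimes>\<^bsub>A\<^esub> F2 [g, k]"
    if gk: "g \<in> carrier G" "k \<in> carrier G" for g k
  proof -
    have b'_at: "b' [x] = b [x] \<otimes>\<^bsub>A\<^esub> h [x]" if "x \<in> carrier G" for x
      using that by (simp add: b'_def tuples_1 del: One_nat_def)
    have "act A g (b [k] \<otimes>\<^bsub>A\<^esub> h [k]) = act A g (b [k]) \<otimes>\<^bsub>A\<^esub> act A g (h [k])"
      using hom_mult[OF act[OF gk(1)]] cl b h gk by blast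
    then have "coboundary G A 1 b' [g, k] = coboundary G A 1 b [g, k] \<otimes>\<^bsub>A\<^esub> coboundary G A 1 h [g, k]"
      using gk cl[OF b] cl[OF h] actcl
      by (simp add: coboundary_1[OF A G b'] coboundary_1[OF A G b]
          coboundary_1[OF A G h] b'_at A.inv_mult A.m_ac del: One_nat_def)
    then show ?thesis
      using gk cl[OF b] cl[OF h] actcl F2
      by (simp add: F1 coboundary_1[OF A G b] coboundary_1[OF A G h] A.m_ac
          del: One_nat_def)
  qed
  then have "c = (\<lambda>xs\<in>tuples G 2. coboundary G A 1 b' xs \<otimes>\<^bsub>A\<^esub> F2 xs)"
    unfolding c by (intro restrict_ext) (auto simp: tuples_2)
  then show "c \<in> cohomology_class G A 2 F2"
    using b' by (auto simp: cohomology_class_def r_coset_def bounded_coboundaries_2 cochain_group_def)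
qed

lemma comm_group_trivial_int_module: "comm_group trivial_int_module"
proof (rule comm_groupI)
  fix x :: int
  show "\<exists>y\<in>carrier trivial_int_module. y \<otimes>\<^bsub>trivial_int_module\<^esub> x = \<one>\<^bsub>trivial_int_module\<^esub>"
    by (simp add: trivial_int_module_def) presburger
qed (auto simp: trivial_int_module_def)

text \<open>At this stage \<open>\<beta>\<close> is merely bounded; its measurability has to be
  recovered from that of \<open>\<psi>\<close>.\<close>

lemma bounded_euler_class_elim:
  assumes "\<psi> \<in> bounded_euler_class"
  obtains \<beta> :: "(circle \<Rightarrow> circle) \<Rightarrow> int" and C :: real where
    "\<And>f. f \<in> carrier homeo_circle \<Longrightarrow> \<bar>of_int (\<beta> f)\<bar> \<le> C"
    "\<And>f g. f \<in> carrier homeo_circle \<Longrightarrow> g \<in> carrier homeo_circle \<Longrightarrow>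
      \<psi> [f, g] = \<beta> g - \<beta> (f \<circ> g) + \<beta> f + euler_cocycle f g"
proof -
  let ?Z = "trivial_int_module :: (int, circle \<Rightarrow> circle) normed_module"
  interpret Z: comm_group ?Z by (rule comm_group_trivial_int_module)
  have inv: "inv\<^bsub>?Z\<^esub> x = - x" for x
    by (rule Z.inv_equality) (auto simp: trivial_int_module_def)
  obtain b where b: "b \<in> bounded_cochains homeo_circle ?Z 1"
    and \<psi>: "\<psi> = (\<lambda>xs\<in>tuples homeo_circle 2. coboundary homeo_circle ?Z 1 b xs \<otimes>\<^bsub>?Z\<^esub>
      (\<lambda>xs\<in>tuples homeo_circle 2. euler_cocycle (xs ! 0) (xs ! 1)) xs)"
    using assms by (auto simp: bounded_euler_class_def cohomology_class_def r_coset_def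
        bounded_coboundaries_2 cochain_group_def)
  obtain C where "\<forall>xs\<in>tuples homeo_circle 1. mnorm ?Z (b xs) \<le> C"
    using b unfolding bounded_cochains_def by blast
  then have C: "\<bar>real_of_int (b [f])\<bar> \<le> C" if "f \<in> carrier homeo_circle" for f
    using that tuples_1[of f homeo_circle] by (auto simp: trivial_int_module_def simp del: One_nat_def)
  show ?thesis
  proof (rule that[of "\<lambda>f. b [f]", OF C])
    fix f g assume fg: "f \<in> carrier homeo_circle" "g \<in> carrier homeo_circle"
    have "coboundary homeo_circle ?Z 1 b [f, g] = b [g] - b [f \<circ> g] + b [f]"
      using coboundary_1[OF comm_group_trivial_int_module group_homeo_circle b fg]
      by (simp add: inv homeo_circle_mult) (simp add: trivial_int_module_def)
    then show "\<psi> [f, g] = b [g] - b [f \<circ> g] + b [f] + euler_cocycle f g"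
      using fg by (simp add: \<psi> tuples_2) (simp add: trivial_int_module_def)
  qed
qed

section \<open>The coefficient module as a normed abelian group\<close>

lemma linf_fun_groupD:
  assumes "f \<in> carrier (linf_fun_group M)"
  shows "f \<in> M \<rightarrow>\<^sub>M count_space UNIV" "\<exists>C. AE \<omega> in M. \<bar>f \<omega>\<bar> \<le> C"
  using assms by (auto simp: linf_fun_group_def)

lemma linf_fun_groupI:
  "f \<in> M \<rightarrow>\<^sub>M count_space UNIV \<Longrightarrow> AE \<omega> in M. \<bar>f \<omega>\<bar> \<le> C \<Longrightarrow> f \<in> carrier (linf_fun_group M)"
  by (auto simp: linf_fun_group_def)

lemma linf_fun_group_simps:
  "f \<otimes>\<^bsub>linf_fun_group M\<^esub> g = (\<lambda>\<omega>. f \<omega> + g \<omega>)" "\<one>\<^bsub>linf_fun_group M\<^esub> = (\<lambda>\<omega>. 0)"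
  by (simp_all add: linf_fun_group_def)

lemma linf_fun_group_add:
  assumes "f \<in> carrier (linf_fun_group M)" "g \<in> carrier (linf_fun_group M)"
  shows "(\<lambda>\<omega>. f \<omega> + g \<omega>) \<in> carrier (linf_fun_group M)"
proof -
  obtain C D where C: "AE \<omega> in M. \<bar>f \<omega>\<bar> \<le> C" and D: "AE \<omega> in M. \<bar>g \<omega>\<bar> \<le> D"
    using linf_fun_groupD[OF assms(1)] linf_fun_groupD[OF assms(2)] by blast
  note [measurable] = linf_fun_groupD(1)[OF assms(1)] linf_fun_groupD(1)[OF assms(2)]
  show ?thesis
  proof (rule linf_fun_groupI)
    show "AE \<omega> in M. \<bar>f \<omega> + g \<omega>\<bar> \<le> C + D" using C D by eventually_elim linarith
  qed measurable
qed

lemma linf_fun_group_uminus: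
  assumes "f \<in> carrier (linf_fun_group M)"
  shows "(\<lambda>\<omega>. - f \<omega>) \<in> carrier (linf_fun_group M)"
proof -
  note [measurable] = linf_fun_groupD(1)[OF assms]
  show ?thesis
    using linf_fun_groupD(2)[OF assms] by (auto intro!: linf_fun_groupI)
qed

lemma linf_fun_group_zero: "(\<lambda>\<omega>. 0) \<in> carrier (linf_fun_group M)"
  by (rule linf_fun_groupI[where C = 0]) auto

lemma comm_group_linf_fun_group: "comm_group (linf_fun_group M)"
proof (rule comm_groupI)
  fix f assume "f \<in> carrier (linf_fun_group M)"
  then show "\<exists>g\<in>carrier (linf_fun_group M). g \<otimes>\<^bsub>linf_fun_group M\<^esub> f = \<one>\<^bsub>linf_fun_group M\<^esub>"
    using linf_fun_group_uminus by (intro bexI[of _ "\<lambda>\<omega>. - f \<omega>"]) (auto simp: linf_fun_group_simps)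
qed (use linf_fun_group_add linf_fun_group_zero in \<open>auto simp: linf_fun_group_simps add_ac\<close>)

lemma inv_linf_fun_group:
  assumes "f \<in> carrier (linf_fun_group M)"
  shows "inv\<^bsub>linf_fun_group M\<^esub> f = (\<lambda>\<omega>. - f \<omega>)"
proof -
  interpret comm_group "linf_fun_group M" by (rule comm_group_linf_fun_group)
  show ?thesis
    by (rule inv_equality) (use assms linf_fun_group_uminus in \<open>auto simp: linf_fun_group_simps\<close>)
qed

lemma normal_null_funs: "null_funs M \<lhd> linf_fun_group M"
proof -
  interpret comm_group "linf_fun_group M" by (rule comm_group_linf_fun_group)
  have "subgroup (null_funs M) (linf_fun_group M)"
  proof (rule subgroupI)
    show "null_funs M \<noteq> {}" using linf_fun_group_zero by (auto simp: null_funs_def)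
    show "inv\<^bsub>linf_fun_group M\<^esub> f \<in> null_funs M" if "f \<in> null_funs M" for f
      using that linf_fun_group_uminus by (auto simp: null_funs_def inv_linf_fun_group)
    show "f \<otimes>\<^bsub>linf_fun_group M\<^esub> g \<in> null_funs M" if "f \<in> null_funs M" "g \<in> null_funs M" for f g
      using that linf_fun_group_add by (auto simp: null_funs_def linf_fun_group_simps)
  qed (auto simp: null_funs_def)
  then show ?thesis by (rule subgroup_imp_normal)
qed

lemma mem_linf_class_iff:
  assumes f: "f \<in> carrier (linf_fun_group M)"
  shows "g \<in> linf_class M f \<longleftrightarrow> g \<in> carrier (linf_fun_group M) \<and> (AE \<omega> in M. g \<omega> = f \<omega>)"
proof
  assume "g \<in> linf_class M f"
  then obtain n where n: "n \<in> null_funs M" "g = (\<lambda>\<omega>. n \<omega> + f \<omega>)"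
    by (auto simp: linf_class_def r_coset_def linf_fun_group_simps)
  then show "g \<in> carrier (linf_fun_group M) \<and> (AE \<omega> in M. g \<omega> = f \<omega>)"
    using linf_fun_group_add f by (auto simp: null_funs_def)
next
  assume g: "g \<in> carrier (linf_fun_group M) \<and> (AE \<omega> in M. g \<omega> = f \<omega>)"
  then have "(\<lambda>\<omega>. g \<omega> + - f \<omega>) \<in> null_funs M"
    using linf_fun_group_add[OF _ linf_fun_group_uminus[OF f]] by (auto simp: null_funs_def)
  then show "g \<in> linf_class M f"
    by (auto simp: linf_class_def r_coset_def linf_fun_group_simps intro!: bexI)
qed

lemma linf_class_eqI:
  assumes "f \<in> carrier (linf_fun_group M)" "g \<in> carrier (linf_fun_group M)" "AE \<omega> in M. f \<omega> = g \<omega>"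
  shows "linf_class M f = linf_class M g"
proof (intro Set.set_eqI)
  fix x
  have "(AE \<omega> in M. x \<omega> = f \<omega>) \<longleftrightarrow> (AE \<omega> in M. x \<omega> = g \<omega>)"
    using assms(3) by (auto elim: AE_mp)
  then show "x \<in> linf_class M f \<longleftrightarrow> x \<in> linf_class M g"
    using assms by (simp add: mem_linf_class_iff)
qed

lemma linf_module_simps:
  "carrier (linf_module G M \<alpha>) = linf_class M ` carrier (linf_fun_group M)"
  "\<one>\<^bsub>linf_module G M \<alpha>\<^esub> = null_funs M"
  "mult (linf_module G M \<alpha>) = set_mult (linf_fun_group M)"
  "mnorm (linf_module G M \<alpha>) X = Inf {C. 0 \<le> C \<and> (\<exists>f\<in>X. AE \<omega> in M. \<bar>of_int (f \<omega>)\<bar> \<le> C)}"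
  "act (linf_module G M \<alpha>) \<gamma> X = (\<Union>f\<in>X. linf_class M (\<lambda>\<omega>. f (\<alpha> (inv\<^bsub>G\<^esub> \<gamma>) \<omega>)))"
  by (auto simp: linf_module_def monoid.extend_def normed_module.fields_def FactGroup_def
      RCOSETS_def linf_class_def)

lemma linf_class_mult:
  assumes "f \<in> carrier (linf_fun_group M)" "g \<in> carrier (linf_fun_group M)"
  shows "linf_class M f \<otimes>\<^bsub>linf_module G M \<alpha>\<^esub> linf_class M g = linf_class M (\<lambda>\<omega>. f \<omega> + g \<omega>)"
  using normal.rcos_sum[OF normal_null_funs assms]
  by (simp add: linf_module_simps linf_class_def) (simp add: linf_fun_group_simps)

lemma linf_class_zero: "linf_class M (\<lambda>\<omega>. 0) = \<one>\<^bsub>linf_module G M \<alpha>\<^esub>"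
  by (auto simp: linf_module_simps mem_linf_class_iff[OF linf_fun_group_zero] null_funs_def)

lemma comm_group_linf_module: "comm_group (linf_module G M \<alpha>)"
proof (rule comm_groupI)
  have one: "\<one>\<^bsub>linf_module G M \<alpha>\<^esub> = linf_class M (\<lambda>\<omega>. 0)" by (rule linf_class_zero[symmetric])
  show "\<one>\<^bsub>linf_module G M \<alpha>\<^esub> \<in> carrier (linf_module G M \<alpha>)"
    unfolding one using linf_fun_group_zero by (auto simp: linf_module_simps)
  fix X Y Z
  assume "X \<in> carrier (linf_module G M \<alpha>)"
  then obtain f where f: "f \<in> carrier (linf_fun_group M)" "X = linf_class M f"
    by (auto simp: linf_module_simps)
  show "\<one>\<^bsub>linf_module G M \<alpha>\<^esub> \<otimes>\<^bsub>linf_module G M \<alpha>\<^esub> X = X"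
    unfolding one f(2) linf_class_mult[OF linf_fun_group_zero f(1)] by simp
  show "\<exists>Y\<in>carrier (linf_module G M \<alpha>). Y \<otimes>\<^bsub>linf_module G M \<alpha>\<^esub> X = \<one>\<^bsub>linf_module G M \<alpha>\<^esub>"
    using linf_fun_group_uminus[OF f(1)] linf_class_mult[OF linf_fun_group_uminus[OF f(1)] f(1)]
    by (auto simp: one f(2) linf_module_simps(1) intro!: bexI[of _ "linf_class M (\<lambda>\<omega>. - f \<omega>)"])
  assume "Y \<in> carrier (linf_module G M \<alpha>)"
  then obtain g where g: "g \<in> carrier (linf_fun_group M)" "Y = linf_class M g"
    by (auto simp: linf_module_simps)
  show "X \<otimes>\<^bsub>linf_module G M \<alpha>\<^esub> Y \<in> carrier (linf_module G M \<alpha>)"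
    unfolding f(2) g(2) linf_class_mult[OF f(1) g(1)]
    using linf_fun_group_add[OF f(1) g(1)] by (auto simp: linf_module_simps)
  show "X \<otimes>\<^bsub>linf_module G M \<alpha>\<^esub> Y = Y \<otimes>\<^bsub>linf_module G M \<alpha>\<^esub> X"
    unfolding f(2) g(2) linf_class_mult[OF f(1) g(1)] linf_class_mult[OF g(1) f(1)]
    by (simp add: add.commute)
  assume "Z \<in> carrier (linf_module G M \<alpha>)"
  then obtain h where h: "h \<in> carrier (linf_fun_group M)" "Z = linf_class M h"
    by (auto simp: linf_module_simps)
  show "X \<otimes>\<^bsub>linf_module G M \<alpha>\<^esub> Y \<otimes>\<^bsub>linf_module G M \<alpha>\<^esub> Z
    = X \<otimes>\<^bsub>linf_module G M \<alpha>\<^esub> (Y \<otimes>\<^bsub>linf_module G M \<alpha>\<^esub> Z)"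
    using f g h by (simp add: linf_class_mult linf_fun_group_add add.assoc)
qed

lemma linf_class_inv:
  assumes "f \<in> carrier (linf_fun_group M)"
  shows "inv\<^bsub>linf_module G M \<alpha>\<^esub> (linf_class M f) = linf_class M (\<lambda>\<omega>. - f \<omega>)"
proof -
  interpret comm_group "linf_module G M \<alpha>" by (rule comm_group_linf_module)
  show ?thesis
    by (rule inv_equality)
       (use assms linf_fun_group_uminus[OF assms] in
        \<open>auto simp: linf_class_mult linf_class_zero linf_module_simps(1)\<close>)
qed

lemma mnorm_linf_class_le:
  assumes "f \<in> carrier (linf_fun_group M)" "0 \<le> C" "AE \<omega> in M. \<bar>of_int (f \<omega>)\<bar> \<le> C"
  shows "mnorm (linf_module G M \<alpha>) (linf_class M f) \<le> C"
  unfolding linf_module_simps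
  by (rule cInf_lower) (use assms in \<open>auto simp: mem_linf_class_iff intro!: bdd_belowI[of _ 0]\<close>)

text \<open>The norm is an infimum over representatives and bounds, so each factor is given a
  representative with an essential bound less than \<open>e / 2\<close> above its norm.\<close>

lemma mnorm_linf_module_triangle:
  assumes "X \<in> carrier (linf_module G M \<alpha>)" "Y \<in> carrier (linf_module G M \<alpha>)"
  shows "mnorm (linf_module G M \<alpha>) (X \<otimes>\<^bsub>linf_module G M \<alpha>\<^esub> Y)
    \<le> mnorm (linf_module G M \<alpha>) X + mnorm (linf_module G M \<alpha>) Y"
proof (rule field_le_epsilon)
  have approx: "\<exists>f C. f \<in> carrier (linf_fun_group M) \<and> X = linf_class M f \<and> 0 \<le> C \<and>
      (AE \<omega> in M. \<bar>of_int (f \<omega>)\<bar> \<le> C) \<and> C < mnorm (linf_module G M \<alpha>) X + e"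
    if X: "X \<in> carrier (linf_module G M \<alpha>)" and "0 < e" for X and e :: real
  proof -
    obtain f where f: "f \<in> carrier (linf_fun_group M)" "X = linf_class M f"
      using X by (auto simp: linf_module_simps)
    obtain B where B: "AE \<omega> in M. \<bar>f \<omega>\<bar> \<le> B" using linf_fun_groupD(2)[OF f(1)] by blast
    then have "AE \<omega> in M. \<bar>real_of_int (f \<omega>)\<bar> \<le> \<bar>of_int B\<bar>"
      by (rule AE_mp) (auto intro!: AE_I2)
    moreover have "f \<in> X" using f by (simp add: mem_linf_class_iff)
    ultimately have "{C. 0 \<le> C \<and> (\<exists>f\<in>X. AE \<omega> in M. \<bar>real_of_int (f \<omega>)\<bar> \<le> C)} \<noteq> {}"
      by (auto intro!: exI[of _ "\<bar>real_of_int B\<bar>"] bexI[of _ f])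
    from cInf_lessD[OF this, of "mnorm (linf_module G M \<alpha>) X + e"]
    obtain C g where C: "0 \<le> C" "g \<in> X" "AE \<omega> in M. \<bar>real_of_int (g \<omega>)\<bar> \<le> C"
      "C < mnorm (linf_module G M \<alpha>) X + e"
      using \<open>0 < e\<close> by (auto simp: linf_module_simps)
    have "g \<in> carrier (linf_fun_group M)" "X = linf_class M g"
      using C(2) f mem_linf_class_iff linf_class_eqI[of f M g] by (auto simp: eq_commute)
    then show ?thesis using C by blast
  qed
  fix e :: real assume "0 < e"
  then have e: "0 < e / 2" by simp
  obtain f C where f: "f \<in> carrier (linf_fun_group M)" "X = linf_class M f" "0 \<le> C"
    "AE \<omega> in M. \<bar>real_of_int (f \<omega>)\<bar> \<le> C" "C < mnorm (linf_module G M \<alpha>) X + e / 2"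
    using approx[OF assms(1) e] by blast
  obtain g D where g: "g \<in> carrier (linf_fun_group M)" "Y = linf_class M g" "0 \<le> D"
    "AE \<omega> in M. \<bar>real_of_int (g \<omega>)\<bar> \<le> D" "D < mnorm (linf_module G M \<alpha>) Y + e / 2"
    using approx[OF assms(2) e] by blast
  have "AE \<omega> in M. \<bar>real_of_int (f \<omega> + g \<omega>)\<bar> \<le> C + D"
    using f(4) g(4) by eventually_elim simp
  then have "mnorm (linf_module G M \<alpha>) (X \<otimes>\<^bsub>linf_module G M \<alpha>\<^esub> Y) \<le> C + D"
    unfolding f(2) g(2) linf_class_mult[OF f(1) g(1)]
    using linf_fun_group_add[OF f(1) g(1)] f(3) g(3) by (intro mnorm_linf_class_le) auto
  then show "mnorm (linf_module G M \<alpha>) (X \<otimes>\<^bsub>linf_module G M \<alpha>\<^esub> Y)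
    \<le> mnorm (linf_module G M \<alpha>) X + mnorm (linf_module G M \<alpha>) Y + e"
    using f(5) g(5) by simp
qed

section \<open>The action on the coefficient module\<close>

lemma standard_borel_probability_actionD:
  assumes "standard_borel_probability_action G M \<alpha>"
  shows "group G" "group_action G (space M) \<alpha>"
    "\<gamma> \<in> carrier G \<Longrightarrow> \<alpha> \<gamma> \<in> M \<rightarrow>\<^sub>M M"
    "\<gamma> \<in> carrier G \<Longrightarrow> AE \<omega> in M. P \<omega> \<Longrightarrow> AE \<omega> in M. P (\<alpha> \<gamma> \<omega>)"
proof -
  show *: "group_action G (space M) \<alpha>" using assms by (simp add: standard_borel_probability_action_def)
  then show "group G" by (auto simp: group_action_def group_hom_def)
  show m: "\<gamma> \<in> carrier G \<Longrightarrow> \<alpha> \<gamma> \<in> M \<rightarrow>\<^sub>M M"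
    using assms by (simp add: standard_borel_probability_action_def)
  show "\<gamma> \<in> carrier G \<Longrightarrow> AE \<omega> in M. P \<omega> \<Longrightarrow> AE \<omega> in M. P (\<alpha> \<gamma> \<omega>)"
  proof -
    assume \<gamma>: "\<gamma> \<in> carrier G" and P: "AE \<omega> in M. P \<omega>"
    have d: "distr M M (\<alpha> \<gamma>) = M"
      using assms \<gamma> by (simp add: standard_borel_probability_action_def)
    have "AE \<omega> in distr M M (\<alpha> \<gamma>). P \<omega>" unfolding d by (rule P)
    then show "AE \<omega> in M. P (\<alpha> \<gamma> \<omega>)" by (rule AE_distrD[OF m[OF \<gamma>]])
  qed
qed

lemma linf_fun_group_act:
  assumes "standard_borel_probability_action G M \<alpha>" "\<gamma> \<in> carrier G" "f \<in> carrier (linf_fun_group M)"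
  shows "(\<lambda>\<omega>. f (\<alpha> \<gamma> \<omega>)) \<in> carrier (linf_fun_group M)"
proof -
  obtain C where "AE \<omega> in M. \<bar>f \<omega>\<bar> \<le> C" using linf_fun_groupD[OF assms(3)] by blast
  from standard_borel_probability_actionD(4)[OF assms(1,2) this] show ?thesis
    using measurable_compose[OF standard_borel_probability_actionD(3)[OF assms(1,2)] linf_fun_groupD(1)[OF assms(3)]]
    by (intro linf_fun_groupI)
qed

text \<open>Because the action preserves the measure, representatives that agree almost everywhere
  still do so after translation. Hence all sets in the union that defines the action
  coincide.\<close>

lemma act_linf_class:
  assumes G: "standard_borel_probability_action G M \<alpha>" and \<gamma>: "\<gamma> \<in> carrier G"
    and f: "f \<in> carrier (linf_fun_group M)"
  shows "act (linf_module G M \<alpha>) \<gamma> (linf_class M f) = linf_class M (\<lambda>\<omega>. f (\<alpha> (inv\<^bsub>G\<^esub> \<gamma>) \<omega>))"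
proof -
  interpret group G using G by (rule standard_borel_probability_actionD)
  have i: "inv\<^bsub>G\<^esub> \<gamma> \<in> carrier G" using \<gamma> by simp
  have "linf_class M (\<lambda>\<omega>. g (\<alpha> (inv\<^bsub>G\<^esub> \<gamma>) \<omega>)) = linf_class M (\<lambda>\<omega>. f (\<alpha> (inv\<^bsub>G\<^esub> \<gamma>) \<omega>))"
    if "g \<in> linf_class M f" for g
    using that f standard_borel_probability_actionD(4)[OF G i, of "\<lambda>\<omega>. g \<omega> = f \<omega>"]
    by (intro linf_class_eqI linf_fun_group_act[OF G i]) (auto simp: mem_linf_class_iff)
  moreover have "f \<in> linf_class M f" using f by (simp add: mem_linf_class_iff)
  ultimately show ?thesis unfolding linf_module_simps by blast
qed

lemma act_linf_module_hom:
  assumes G: "standard_borel_probability_action G M \<alpha>" and \<gamma>: "\<gamma> \<in> carrier G"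
  shows "act (linf_module G M \<alpha>) \<gamma> \<in> hom (linf_module G M \<alpha>) (linf_module G M \<alpha>)"
proof -
  interpret group G using G by (rule standard_borel_probability_actionD)
  have i: "inv\<^bsub>G\<^esub> \<gamma> \<in> carrier G" using \<gamma> by simp
  show ?thesis
    using linf_fun_group_act[OF G i]
    by (intro homI)
       (auto simp: linf_module_simps(1) act_linf_class[OF G \<gamma>] linf_class_mult linf_fun_group_add)
qed

text \<open>Translates the coset computation into functions of \<open>\<omega>\<close>: the
  hypothesis on \<open>h\<close> is the degree one coboundary formula with the action written out
  pointwise.\<close>

lemma linf_cohomology_class_subset:
  assumes G: "standard_borel_probability_action G M \<alpha>"
    and \<Psi>\<^sub>2: "\<And>\<gamma> \<eta>. \<gamma> \<in> carrier G \<Longrightarrow> \<eta> \<in> carrier G \<Longrightarrow> \<Psi>\<^sub>2 \<gamma> \<eta> \<in> carrier (linf_fun_group M)"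
    and \<Psi>\<^sub>1: "\<And>\<gamma> \<eta>. \<gamma> \<in> carrier G \<Longrightarrow> \<eta> \<in> carrier G \<Longrightarrow> \<Psi>\<^sub>1 \<gamma> \<eta> \<in> carrier (linf_fun_group M)"
    and h: "\<And>\<gamma>. \<gamma> \<in> carrier G \<Longrightarrow> h \<gamma> \<in> M \<rightarrow>\<^sub>M count_space UNIV"
    and bdd: "\<And>\<gamma> \<omega>. \<gamma> \<in> carrier G \<Longrightarrow> \<omega> \<in> space M \<Longrightarrow> \<bar>real_of_int (h \<gamma> \<omega>)\<bar> \<le> C"
    and eq: "\<And>\<gamma> \<eta>. \<gamma> \<in> carrier G \<Longrightarrow> \<eta> \<in> carrier G \<Longrightarrow> AE \<omega> in M.
      \<Psi>\<^sub>1 \<gamma> \<eta> \<omega> = h \<eta> (\<alpha> (inv\<^bsub>G\<^esub> \<gamma>) \<omega>) - h (\<gamma> \<otimes>\<^bsub>G\<^esub> \<eta>) \<omega> + h \<gamma> \<omega> + \<Psi>\<^sub>2 \<gamma> \<eta> \<omega>"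
  shows "cohomology_class G (linf_module G M \<alpha>) 2 (\<lambda>xs\<in>tuples G 2. linf_class M (\<Psi>\<^sub>1 (xs ! 0) (xs ! 1)))
    \<subseteq> cohomology_class G (linf_module G M \<alpha>) 2 (\<lambda>xs\<in>tuples G 2. linf_class M (\<Psi>\<^sub>2 (xs ! 0) (xs ! 1)))"
proof -
  interpret group G using G by (rule standard_borel_probability_actionD)
  let ?A = "linf_module G M \<alpha>"
  have hL: "h \<gamma> \<in> carrier (linf_fun_group M)" if "\<gamma> \<in> carrier G" for \<gamma>
  proof (rule linf_fun_groupI[OF h[OF that]])
    \<comment> \<open>Membership in \<open>linf_fun_group\<close> asks for an integer bound, while
      the norm takes a real one.\<close>
    have "\<bar>h \<gamma> \<omega>\<bar> \<le> \<lfloor>C\<rfloor>" if "\<omega> \<in> space M" for \<omega>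
      using bdd[OF \<open>\<gamma> \<in> carrier G\<close> that] by linarith
    then show "AE \<omega> in M. \<bar>h \<gamma> \<omega>\<bar> \<le> \<lfloor>C\<rfloor>" by simp
  qed
  define h' where "h' = (\<lambda>xs\<in>tuples G 1. linf_class M (h (hd xs)))"
  have h'_at: "h' [\<gamma>] = linf_class M (h \<gamma>)" if "\<gamma> \<in> carrier G" for \<gamma>
    using that by (simp add: h'_def tuples_1 del: One_nat_def)
  have h': "h' \<in> bounded_cochains G ?A 1"
  proof -
    have hd: "hd xs \<in> carrier G" if "xs \<in> tuples G 1" for xs
      using that by (cases xs) (auto simp: tuples_def)
    have "mnorm ?A (linf_class M (h \<gamma>)) \<le> \<bar>C\<bar>" if "\<gamma> \<in> carrier G" for \<gamma>
      using order.trans[OF bdd[OF that] abs_ge_self] hL[OF that]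
      by (intro mnorm_linf_class_le) (auto intro!: AE_I2)
    then show ?thesis
      using hL hd by (auto simp: bounded_cochains_def h'_def linf_module_simps(1) intro!: exI[of _ "\<bar>C\<bar>"])
  qed
  show ?thesis
  proof (rule cohomology_class_2_subset[OF comm_group_linf_module is_group act_linf_module_hom[OF G]
        mnorm_linf_module_triangle h'])
    fix \<gamma> \<eta> assume \<gamma>: "\<gamma> \<in> carrier G" and \<eta>: "\<eta> \<in> carrier G"
    then show "(\<lambda>xs\<in>tuples G 2. linf_class M (\<Psi>\<^sub>2 (xs ! 0) (xs ! 1))) [\<gamma>, \<eta>] \<in> carrier ?A"
      using \<Psi>\<^sub>2 by (auto simp: tuples_2 linf_module_simps(1))
    have i: "inv\<^bsub>G\<^esub> \<gamma> \<in> carrier G" using \<gamma> by simp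
    have "coboundary G ?A 1 h' [\<gamma>, \<eta>] \<otimes>\<^bsub>?A\<^esub> linf_class M (\<Psi>\<^sub>2 \<gamma> \<eta>) = linf_class M (\<lambda>\<omega>.
        h \<eta> (\<alpha> (inv\<^bsub>G\<^esub> \<gamma>) \<omega>) + - h (\<gamma> \<otimes>\<^bsub>G\<^esub> \<eta>) \<omega> + h \<gamma> \<omega> + \<Psi>\<^sub>2 \<gamma> \<eta> \<omega>)"
      using \<gamma> \<eta> hL \<Psi>\<^sub>2 linf_fun_group_act[OF G i]
      by (simp add: coboundary_1[OF comm_group_linf_module is_group h']
          h'_at act_linf_class[OF G \<gamma>] linf_class_inv linf_class_mult linf_fun_group_add
          linf_fun_group_uminus del: One_nat_def add_uminus_conv_diff)
    also have "\<dots> = linf_class M (\<Psi>\<^sub>1 \<gamma> \<eta>)"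
    proof (rule linf_class_eqI[symmetric, OF \<Psi>\<^sub>1[OF \<gamma> \<eta>]])
      show "(\<lambda>\<omega>. h \<eta> (\<alpha> (inv\<^bsub>G\<^esub> \<gamma>) \<omega>) + - h (\<gamma> \<otimes>\<^bsub>G\<^esub> \<eta>) \<omega> + h \<gamma> \<omega> + \<Psi>\<^sub>2 \<gamma> \<eta> \<omega>)
          \<in> carrier (linf_fun_group M)"
        by (intro linf_fun_group_add linf_fun_group_uminus linf_fun_group_act[OF G i] hL \<Psi>\<^sub>2 m_closed \<gamma> \<eta>)
      show "AE \<omega> in M. \<Psi>\<^sub>1 \<gamma> \<eta> \<omega> =
          h \<eta> (\<alpha> (inv\<^bsub>G\<^esub> \<gamma>) \<omega>) + - h (\<gamma> \<otimes>\<^bsub>G\<^esub> \<eta>) \<omega> + h \<gamma> \<omega> + \<Psi>\<^sub>2 \<gamma> \<eta> \<omega>"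
        using eq[OF \<gamma> \<eta>] by simp
    qed
    finally show "(\<lambda>xs\<in>tuples G 2. linf_class M (\<Psi>\<^sub>1 (xs ! 0) (xs ! 1))) [\<gamma>, \<eta>] =
      coboundary G ?A 1 h' [\<gamma>, \<eta>] \<otimes>\<^bsub>?A\<^esub> (\<lambda>xs\<in>tuples G 2. linf_class M (\<Psi>\<^sub>2 (xs ! 0) (xs ! 1))) [\<gamma>, \<eta>]"
      using \<gamma> \<eta> by (simp add: tuples_2)
  qed
qed

lemma linf_cohomology_class_eq:
  assumes G: "standard_borel_probability_action G M \<alpha>"
    and \<Psi>\<^sub>1: "\<And>\<gamma> \<eta>. \<gamma> \<in> carrier G \<Longrightarrow> \<eta> \<in> carrier G \<Longrightarrow> \<Psi>\<^sub>1 \<gamma> \<eta> \<in> carrier (linf_fun_group M)"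
    and \<Psi>\<^sub>2: "\<And>\<gamma> \<eta>. \<gamma> \<in> carrier G \<Longrightarrow> \<eta> \<in> carrier G \<Longrightarrow> \<Psi>\<^sub>2 \<gamma> \<eta> \<in> carrier (linf_fun_group M)"
    and h: "\<And>\<gamma>. \<gamma> \<in> carrier G \<Longrightarrow> h \<gamma> \<in> M \<rightarrow>\<^sub>M count_space UNIV"
    and bdd: "\<And>\<gamma> \<omega>. \<gamma> \<in> carrier G \<Longrightarrow> \<omega> \<in> space M \<Longrightarrow> \<bar>real_of_int (h \<gamma> \<omega>)\<bar> \<le> C"
    and eq: "\<And>\<gamma> \<eta>. \<gamma> \<in> carrier G \<Longrightarrow> \<eta> \<in> carrier G \<Longrightarrow> AE \<omega> in M.
      \<Psi>\<^sub>1 \<gamma> \<eta> \<omega> - \<Psi>\<^sub>2 \<gamma> \<eta> \<omega> = h \<eta> (\<alpha> (inv\<^bsub>G\<^esub> \<gamma>) \<omega>) - h (\<gamma> \<otimes>\<^bsub>G\<^esub> \<eta>) \<omega> + h \<gamma> \<omega>"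
  shows "cohomology_class G (linf_module G M \<alpha>) 2 (\<lambda>xs\<in>tuples G 2. linf_class M (\<Psi>\<^sub>1 (xs ! 0) (xs ! 1)))
    = cohomology_class G (linf_module G M \<alpha>) 2 (\<lambda>xs\<in>tuples G 2. linf_class M (\<Psi>\<^sub>2 (xs ! 0) (xs ! 1)))"
proof (rule antisym)
  show "cohomology_class G (linf_module G M \<alpha>) 2 (\<lambda>xs\<in>tuples G 2. linf_class M (\<Psi>\<^sub>1 (xs ! 0) (xs ! 1)))
    \<subseteq> cohomology_class G (linf_module G M \<alpha>) 2 (\<lambda>xs\<in>tuples G 2. linf_class M (\<Psi>\<^sub>2 (xs ! 0) (xs ! 1)))"
  proof (rule linf_cohomology_class_subset[OF G \<Psi>\<^sub>2 \<Psi>\<^sub>1 h bdd])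
    fix \<gamma> \<eta> assume "\<gamma> \<in> carrier G" "\<eta> \<in> carrier G"
    from eq[OF this] show "AE \<omega> in M. \<Psi>\<^sub>1 \<gamma> \<eta> \<omega> =
        h \<eta> (\<alpha> (inv\<^bsub>G\<^esub> \<gamma>) \<omega>) - h (\<gamma> \<otimes>\<^bsub>G\<^esub> \<eta>) \<omega> + h \<gamma> \<omega> + \<Psi>\<^sub>2 \<gamma> \<eta> \<omega>"
      by eventually_elim simp
  qed
  show "cohomology_class G (linf_module G M \<alpha>) 2 (\<lambda>xs\<in>tuples G 2. linf_class M (\<Psi>\<^sub>2 (xs ! 0) (xs ! 1)))
    \<subseteq> cohomology_class G (linf_module G M \<alpha>) 2 (\<lambda>xs\<in>tuples G 2. linf_class M (\<Psi>\<^sub>1 (xs ! 0) (xs ! 1)))"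
  proof (rule linf_cohomology_class_subset[OF G \<Psi>\<^sub>1 \<Psi>\<^sub>2, where h = "\<lambda>\<gamma> \<omega>. - h \<gamma> \<omega>" and C = C])
    fix \<gamma> \<eta> assume "\<gamma> \<in> carrier G" "\<eta> \<in> carrier G"
    from eq[OF this] show "AE \<omega> in M. \<Psi>\<^sub>2 \<gamma> \<eta> \<omega> =
        - h \<eta> (\<alpha> (inv\<^bsub>G\<^esub> \<gamma>) \<omega>) - - h (\<gamma> \<otimes>\<^bsub>G\<^esub> \<eta>) \<omega> + - h \<gamma> \<omega> + \<Psi>\<^sub>1 \<gamma> \<eta> \<omega>"
      by eventually_elim simp
  next
    fix \<gamma> assume "\<gamma> \<in> carrier G"
    note [measurable] = h[OF this]
    show "(\<lambda>\<omega>. - h \<gamma> \<omega>) \<in> M \<rightarrow>\<^sub>M count_space UNIV" by measurable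
  qed (use bdd in auto)
qed

section \<open>Monotone maps of the circle and their lifts\<close>

lemma nondecreasing_degree_oneE:
  assumes "nondecreasing_degree_one f"
  obtains F where "mono F" "\<And>x. F (x + 1) = F x + 1" "is_lift F f"
    "F 0 = circle_coord (f (circle_proj 0))"
proof -
  obtain F where F: "mono F" "\<And>x. F (x + 1) = F x + 1" "is_lift F f"
    using assms by (auto simp: nondecreasing_degree_one_iff_lift)
  let ?F = "\<lambda>x. F x + of_int (- \<lfloor>F 0\<rfloor>)"
  show ?thesis
  proof (rule that[of ?F])
    show "mono ?F" using F(1) by (auto simp: mono_def)
    show "is_lift ?F f" using F(3) by (rule is_lift_comp_translation)
    have "f (circle_proj 0) = circle_proj (F 0)" using F(3) by (simp add: is_lift_def)
    then show "?F 0 = circle_coord (f (circle_proj 0))" by (simp add: circle_coord_proj frac_def)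
  qed (simp add: F(2))
qed

text \<open>Constant maps are included. One exceptional point is tolerated because the value at a
  single irrational point escapes every condition on rational points.\<close>

definition constant_off_point :: "(circle \<Rightarrow> circle) \<Rightarrow> bool"
  where "constant_off_point f \<longleftrightarrow> (\<exists>b p. \<forall>x. x \<noteq> b \<longrightarrow> f x = p)"

abbreviation rat_point :: "rat \<Rightarrow> circle"
  where "rat_point q \<equiv> circle_proj (of_rat q)"

text \<open>A countable, hence measurable, reformulation of being constant off one point.\<close>

definition constant_off_rat :: "(circle \<Rightarrow> circle) \<Rightarrow> bool"
  where "constant_off_rat f \<longleftrightarrow> (\<exists>q. \<forall>r r'. rat_point r \<noteq> rat_point q \<longrightarrow> rat_point r' \<noteq> rat_point q
    \<longrightarrow> f (rat_point r) = f (rat_point r'))"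

text \<open>If both values differed from \<open>p\<close>, take \<open>g\<close> between
  \<open>x\<close> and \<open>y\<close>, and \<open>g'\<close> between \<open>y\<close> and x + 1,
  with value \<open>p\<close>. Then \<open>F g' - F g\<close> is an integer, positive because
  \<open>F y\<close> lies strictly between, and yet less than 1 because \<open>F x < F g\<close> and
  \<open>F g' \<le> F x + 1\<close>.\<close>

lemma exceptional_point_unique:
  assumes F: "mono F" "\<And>x. F (x + 1) = F x + 1" "is_lift F f"
    and dense: "\<And>x y. x < y \<Longrightarrow> \<exists>g\<in>G. x < g \<and> g < y"
    and const: "\<And>g. g \<in> G \<Longrightarrow> f (circle_proj g) = p"
    and xy: "x < y" "y < x + 1"
  shows "f (circle_proj x) = p \<or> f (circle_proj y) = p"
proof (rule ccontr)
  assume not: "\<not> ?thesis"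
  obtain g where g: "g \<in> G" "x < g" "g < y" using dense[OF xy(1)] by blast
  obtain g' where g': "g' \<in> G" "y < g'" "g' < x + 1" using dense[OF xy(2)] by blast
  have lift: "circle_proj (F t) = f (circle_proj t)" for t using F(3) by (simp add: is_lift_def)
  have "F x \<le> F g" "F g \<le> F y" "F y \<le> F g'" "F g' \<le> F (x + 1)"
    using g g' by (intro monoD[OF F(1)]; simp)+
  moreover have "F x \<noteq> F g" "F g \<noteq> F y" "F y \<noteq> F g'"
    using not const[OF g(1)] const[OF g'(1)] lift by metis+
  moreover obtain n where "F g' - F g = of_int n"
    using circle_proj_eqE[of "F g'" "F g"] lift const[OF g(1)] const[OF g'(1)] by metis
  moreover from calculation have "of_int n > (0::real)" by linarith
  moreover from this have "of_int n \<ge> (1::real)" by simp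
  ultimately show False using F(2)[of x] by linarith
qed

lemma circle_proj_eq_near: "circle_proj x = circle_proj y \<Longrightarrow> \<bar>x - y\<bar> < 1 \<Longrightarrow> x = y"
proof (elim circle_proj_eqE)
  fix n assume "\<bar>x - y\<bar> < 1" "x - y = of_int n"
  then have "\<bar>n\<bar> < 1" by linarith
  with \<open>x - y = of_int n\<close> show "x = y" by simp
qed

text \<open>Monotonicity makes the countable test sufficient: the rational points away from
  \<open>q\<close> are dense and share one value, so by \<open>exceptional_point_unique\<close> at
  most one point of the circle deviates.\<close>

lemma constant_off_rat_iff:
  assumes "nondecreasing_degree_one f"
  shows "constant_off_rat f \<longleftrightarrow> constant_off_point f"
proof
  assume "constant_off_point f"
  then obtain b p where bp: "\<And>x. x \<noteq> b \<Longrightarrow> f x = p" by (auto simp: constant_off_point_def)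
  show "constant_off_rat f"
  proof (cases "\<exists>q. b = rat_point q")
    case True
    then obtain q where "b = rat_point q" ..
    then show ?thesis unfolding constant_off_rat_def using bp by (intro exI[of _ q]) metis
  next
    \<comment> \<open>No rational point is exceptional, so any rational, here 0, can serve as
      \<open>q\<close>.\<close>
    case False
    then show ?thesis unfolding constant_off_rat_def using bp by (intro exI[of _ 0]) metis
  qed
next
  assume "constant_off_rat f"
  then obtain q where q: "\<And>r r'. rat_point r \<noteq> rat_point q \<Longrightarrow> rat_point r' \<noteq> rat_point q
    \<Longrightarrow> f (rat_point r) = f (rat_point r')" by (auto simp: constant_off_rat_def)
  define G where "G = real_of_rat ` {r. rat_point r \<noteq> rat_point q}"
  have dense: "\<exists>g\<in>G. x < g \<and> g < y" if xy: "x < y" for x y :: real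
  proof -
    obtain r where r: "x < of_rat r" "of_rat r < y" using of_rat_dense[OF xy] by blast
    \<comment> \<open>Less than 1 apart, \<open>r\<close> and \<open>r'\<close> give different
      points of the circle, so at most one of them is the excluded one.\<close>
    then obtain r' where r': "of_rat r < (of_rat r' :: real)" "of_rat r' < min y (of_rat r + 1)"
      using of_rat_dense[of "of_rat r" "min y (of_rat r + 1)"] by auto
    have "rat_point r \<noteq> rat_point r'" using circle_proj_eq_near[of "of_rat r'" "of_rat r"] r' by auto
    then have "of_rat r \<in> G \<or> of_rat r' \<in> G" by (auto simp: G_def)
    then show ?thesis
    proof
      assume "of_rat r \<in> G" then show ?thesis using r by blast
    next
      assume "of_rat r' \<in> G" then show ?thesis using r r' by (intro bexI[of _ "of_rat r'"]) auto
    qed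
  qed
  obtain g where g: "g \<in> G" using dense[of 0 1] by auto
  define p where "p = f (circle_proj g)"
  have const: "f (circle_proj g) = p" if "g \<in> G" for g
    using that g q unfolding G_def p_def by auto
  obtain F where F: "mono F" "\<And>x. F (x + 1) = F x + 1" "is_lift F f"
    using nondecreasing_degree_oneE[OF assms] by metis
  have "f x = p" if "f b \<noteq> p" "x \<noteq> b" for b x
  proof -
    obtain u where u: "circle_proj u = b" by (rule circle_proj_surj)
    obtain t where t: "u \<le> t" "t < u + 1" "circle_proj t = x" by (rule circle_proj_lift_ge)
    have "u \<noteq> t" using u t that by auto
    then show ?thesis
      using exceptional_point_unique[OF F dense const, of u t] u t that by auto
  qed
  then show "constant_off_point f" unfolding constant_off_point_def by metis
qed

text \<open>At most one of three points is exceptional, so three values determine the constant.\<close>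

definition generic_value :: "(circle \<Rightarrow> circle) \<Rightarrow> circle"
  where "generic_value f = (if f (circle_proj 0) = f (circle_proj (1/3))
    then f (circle_proj 0) else f (circle_proj (2/3)))"

lemma generic_value_eq:
  assumes "\<And>x. x \<noteq> b \<Longrightarrow> f x = p"
  shows "generic_value f = p"
proof -
  have "circle_proj 0 \<noteq> circle_proj (1/3)" "circle_proj 0 \<noteq> circle_proj (2/3)"
    "circle_proj (1/3) \<noteq> circle_proj (2/3)"
    using circle_proj_eq_near[of 0 "1/3"] circle_proj_eq_near[of 0 "2/3"]
      circle_proj_eq_near[of "1/3" "2/3"] by auto
  then show ?thesis unfolding generic_value_def using assms by metis
qed

lemma constant_off_point_equivariant:
  assumes "bij s\<^sub>1" "bij s\<^sub>2" "s\<^sub>1 \<circ> f = g \<circ> s\<^sub>2"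
  shows "constant_off_point g \<longleftrightarrow> constant_off_point f"
    and "constant_off_point f \<Longrightarrow> generic_value g = s\<^sub>1 (generic_value f)"
proof -
  have eq: "s\<^sub>1 (f x) = g (s\<^sub>2 x)" for x using assms(3) by (metis comp_apply)
  have *: "\<And>x. x \<noteq> s\<^sub>2 b \<Longrightarrow> g x = s\<^sub>1 p" if "\<And>x. x \<noteq> b \<Longrightarrow> f x = p" for b p
    using that eq assms(2) by (metis bij_pointE)
  show "constant_off_point f \<Longrightarrow> generic_value g = s\<^sub>1 (generic_value f)"
    unfolding constant_off_point_def using * generic_value_eq by metis
  have "constant_off_point f" if "\<And>x. x \<noteq> b \<Longrightarrow> g x = p" for b p
  proof -
    obtain b' where "b = s\<^sub>2 b'" using assms(2) by (metis bij_pointE)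
    moreover obtain p' where "p = s\<^sub>1 p'" using assms(1) by (metis bij_pointE)
    ultimately have "f x = p'" if "x \<noteq> b'" for x
      using that \<open>\<And>x. x \<noteq> b \<Longrightarrow> g x = p\<close> eq assms(1,2) by (metis bij_pointE)
    then show ?thesis by (auto simp: constant_off_point_def)
  qed
  then show "constant_off_point g \<longleftrightarrow> constant_off_point f"
    using * unfolding constant_off_point_def by metis
qed

text \<open>The lift whose value at 0 is the coordinate of \<open>f (circle_proj 0)\<close>,
  expressed so that it is Borel in \<open>f\<close>. If the values at \<open>x\<close> and 0 differ,
  the gain since the last integer lies strictly between 0 and 1 and is a fractional part. If they
  agree, the gain is 0 or 1, and it is 1 exactly when the map has left its initial value at an
  earlier rational point.\<close>

definition canonical_lift :: "(circle \<Rightarrow> circle) \<Rightarrow> real \<Rightarrow> real"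
  where "canonical_lift f x = circle_coord (f (circle_proj 0)) + of_int \<lfloor>x\<rfloor> +
    (if f (circle_proj x) = f (circle_proj 0)
     then if \<exists>q. 0 < real_of_rat q \<and> real_of_rat q < frac x \<and> f (rat_point q) \<noteq> f (circle_proj 0) then 1 else 0
     else frac (circle_coord (f (circle_proj x)) - circle_coord (f (circle_proj 0))))"

lemma canonical_lift:
  assumes f: "nondecreasing_degree_one f" "\<not> constant_off_point f"
  shows "mono (canonical_lift f)" "is_lift (canonical_lift f) f"
proof -
  obtain F where F: "mono F" "\<And>x. F (x + 1) = F x + 1" "is_lift F f"
    and F0: "F 0 = circle_coord (f (circle_proj 0))"
    using nondecreasing_degree_oneE[OF f(1)] by metis
  have lift: "f (circle_proj t) = circle_proj (F t)" for t using F(3) by (simp add: is_lift_def)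
  \<comment> \<open>Otherwise all rational points share one value, and \<open>f\<close> is constant
    off one point.\<close>
  obtain q where q: "f (rat_point q) \<noteq> f (circle_proj 0)"
    using f constant_off_rat_iff[OF f(1)] unfolding constant_off_rat_def by metis
  have "F x = canonical_lift f x" for x
  proof -
    define t where "t = frac x"
    have t: "0 \<le> t" "t < 1" "circle_proj t = circle_proj x" by (simp_all add: t_def frac_lt_1)
    have Fx: "F x = F t + of_int \<lfloor>x\<rfloor>" unfolding t_def by (rule degree_one_frac) (rule F(2))
    have bds: "F 0 \<le> F t" "F t \<le> F 0 + 1"
      using monoD[OF F(1) t(1)] monoD[OF F(1), of t 1] t(2) F(2)[of 0] by simp_all
    show ?thesis
    proof (cases "f (circle_proj x) = f (circle_proj 0)")
      case True
      then have "circle_proj (F t) = circle_proj (F 0)" using lift t(3) by metis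
      then obtain n where n: "F t - F 0 = of_int n" by (rule circle_proj_eqE)
      then have "0 \<le> n" "n \<le> 1" using bds by linarith+
      then have n01: "n = 0 \<or> n = 1" by auto
      show ?thesis
      proof (cases "\<exists>q. 0 < real_of_rat q \<and> real_of_rat q < t \<and> f (rat_point q) \<noteq> f (circle_proj 0)")
        case ex: True
        then obtain r where r: "0 < real_of_rat r" "of_rat r < t" "f (rat_point r) \<noteq> f (circle_proj 0)"
          by blast
        have "F 0 \<le> F (of_rat r)" "F (of_rat r) \<le> F t" using r by (intro monoD[OF F(1)]; simp)+
        moreover have "F 0 \<noteq> F (of_rat r)" using r lift by metis
        ultimately have "n = 1" using n01 n by auto
        then show ?thesis using True ex n Fx F0 by (simp add: canonical_lift_def t_def)
      next
        case nex: False
        \<comment> \<open>Move \<open>q\<close> by an integer to \<open>s\<close> in (0, 1). No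
          rational before \<open>t\<close> leaves the initial value, so \<open>s\<close> is at least
          \<open>t\<close>. A full turn completed at \<open>t\<close> would leave the lift still up
          to 1, and \<open>f\<close> would take its initial value at \<open>s\<close>.\<close>
        have "n = 0"
        proof (rule ccontr)
          assume "n \<noteq> 0"
          then have n1: "F t = F 0 + 1" using n01 n by auto
          define s where "s = frac (real_of_rat q)"
          have s: "0 \<le> s" "s < 1" "circle_proj s = rat_point q" by (simp_all add: s_def frac_lt_1)
          have "s = of_rat (q - of_int \<lfloor>q\<rfloor>)" by (simp add: s_def frac_def of_rat_diff)
          then obtain q' where q': "s = of_rat q'" by blast
          have "s \<noteq> 0" using q s by auto
          then have "\<not> s < t" using nex q s q' by (metis less_eq_real_def)
          then have "F t \<le> F s" "F s \<le> F (0 + 1)" using s by (intro monoD[OF F(1)]; simp)+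
          then have "F s = F 0 + 1" using n1 F(2)[of 0] by simp
          then show False using q s lift circle_proj_add_int[of "F 0" 1] by (metis of_int_1)
        qed
        then show ?thesis using True nex n Fx F0 by (simp add: canonical_lift_def t_def)
      qed
    next
      case False
      then have "circle_proj (F t) \<noteq> circle_proj (F 0)" using lift t(3) by metis
      then have "F t \<noteq> F 0 + 1" using circle_proj_add_int[of "F 0" 1] by (metis of_int_1)
      then have "F t < F 0 + 1" using bds by simp
      moreover have "circle_coord (f (circle_proj x)) = frac (F t)"
        using lift t(3) circle_coord_proj by metis
      moreover have "frac (frac (F t) - F 0) = F t - F 0"
        using bds \<open>F t < F 0 + 1\<close> by (simp add: frac_unique_iff) (simp add: frac_def)
      ultimately show ?thesis using False Fx F0 by (simp add: canonical_lift_def)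
    qed
  qed
  then have "F = canonical_lift f" by auto
  then show "mono (canonical_lift f)" "is_lift (canonical_lift f) f" using F by auto
qed

lemma canonical_lift_add_one: "canonical_lift f (x + 1) = canonical_lift f x + 1"
  using circle_proj_add_int[of x 1] by (simp add: canonical_lift_def frac_def)

text \<open>A constant map has a lift up to translation for every choice of the jump. If \<open>f\<close> is constant
  off one point, replace it by the constant map with its generic value and select the lift with its
  jump at \<open>z\<close>; constancy itself would be a condition on uncountably many values.\<close>

definition selected_lift :: "(circle \<Rightarrow> circle) \<Rightarrow> real \<Rightarrow> real \<Rightarrow> real"
  where "selected_lift f z x = (if constant_off_rat f
    then circle_coord (generic_value f) + of_int \<lfloor>x - z\<rfloor> else canonical_lift f x)"

lemma selected_lift_add_int: "selected_lift f z (x + of_int n) = selected_lift f z x + of_int n"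
proof (rule degree_one_int)
  show "selected_lift f z (x + 1) = selected_lift f z x + 1" for x
  proof -
    have "\<lfloor>x + 1 - z\<rfloor> = \<lfloor>x - z\<rfloor> + 1" by linarith
    then show ?thesis by (simp add: selected_lift_def canonical_lift_add_one)
  qed
qed

text \<open>The constants are crude; what counts is that they are uniform in \<open>f\<close> and
  \<open>z\<close>, which makes the integer cochain bounded.\<close>

lemma selected_lift_bounds:
  assumes "0 \<le> z" "z < 1" "0 \<le> x" "x < 1"
  shows "- 1 \<le> selected_lift f z x" "selected_lift f z x \<le> 3"
proof -
  have "- 1 \<le> \<lfloor>x - z\<rfloor>" "\<lfloor>x - z\<rfloor> \<le> 1" using assms by linarith+
  then have fl: "- 1 \<le> real_of_int \<lfloor>x - z\<rfloor>" "real_of_int \<lfloor>x - z\<rfloor> \<le> 1" by linarith+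
  have "\<lfloor>x\<rfloor> = 0" using assms by (simp add: floor_eq_iff)
  then obtain d where "canonical_lift f x = circle_coord (f (circle_proj 0)) + d" "0 \<le> d" "d \<le> 1"
    by (auto simp: canonical_lift_def frac_lt_1 less_imp_le)
  then have can: "0 \<le> canonical_lift f x" "canonical_lift f x \<le> 2"
    using circle_coord_bounds[of "f (circle_proj 0)"] by linarith+
  have "selected_lift f z x = circle_coord (generic_value f) + of_int \<lfloor>x - z\<rfloor> \<or>
    selected_lift f z x = canonical_lift f x"
    by (simp add: selected_lift_def)
  then show "- 1 \<le> selected_lift f z x" "selected_lift f z x \<le> 3"
    using fl can circle_coord_bounds[of "generic_value f"] by linarith+
qed

text \<open>A lift \<open>S\<close> of a homeomorphism carries the period [z + k, z + k + 1) to [S z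
  + k, S z + k + 1). So precomposing a step lift with \<open>S\<close> amounts to moving its
  jump.\<close>

lemma floor_lift_section_diff:
  assumes "s \<in> carrier homeo_circle"
  shows "\<lfloor>lift_section s x - lift_section s z\<rfloor> = \<lfloor>x - z\<rfloor>"
proof -
  define k where "k = \<lfloor>x - z\<rfloor>"
  have tr: "lift_section s (z + of_int n) = lift_section s z + of_int n" for n
    by (rule degree_one_int) (rule lift_section_add_one[OF assms])
  have "z + of_int k \<le> x" "x < z + of_int (k + 1)" unfolding k_def by linarith+
  then have "lift_section s (z + of_int k) \<le> lift_section s x"
    "lift_section s x < lift_section s (z + of_int (k + 1))"
    using monoD[OF lift_section_mono[OF assms]] strict_monoD[OF lift_section_strict_mono[OF assms]]
    by blast+
  then have "\<lfloor>lift_section s x - lift_section s z\<rfloor> = k"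
    unfolding tr by (simp add: floor_eq_iff algebra_simps)
  then show ?thesis by (simp add: k_def)
qed

text \<open>If \<open>f\<close> is constant off one point, both sides are step functions of the same
  shape, since the hypothesis on \<open>z\<close> carries the jump of one to the jump of the other.
  Otherwise both sides lift \<open>s\<^sub>1 \<circ> f\<close>, and lifts of a map with two values
  differ by an integer.\<close>

lemma selected_lift_equivariant:
  assumes s: "s\<^sub>1 \<in> carrier homeo_circle" "s\<^sub>2 \<in> carrier homeo_circle"
    and f: "nondecreasing_degree_one f" and g: "nondecreasing_degree_one g"
    and eq: "s\<^sub>1 \<circ> f = g \<circ> s\<^sub>2"
    and z: "constant_off_point f \<Longrightarrow> s\<^sub>2 (circle_proj z) = circle_proj z'"
  shows "\<exists>n::int. \<forall>x. lift_section s\<^sub>1 (selected_lift f z x) =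
    selected_lift g z' (lift_section s\<^sub>2 x) + of_int n"
proof -
  note bij = homeo_circleD(2)[OF s(1)] homeo_circleD(2)[OF s(2)]
  note equi = constant_off_point_equivariant[OF bij eq]
  show ?thesis
  proof (cases "constant_off_point f")
    case True
    let ?c = "circle_coord (generic_value f)" and ?d = "circle_coord (generic_value g)"
    have F: "constant_off_rat f" "constant_off_rat g"
      using True equi(1) constant_off_rat_iff f g by blast+
    have "circle_proj (lift_section s\<^sub>1 ?c) = circle_proj ?d"
      using equi(2)[OF True] by (simp add: circle_proj_lift_section[OF s(1)])
    then obtain m where m: "lift_section s\<^sub>1 ?c - ?d = of_int m" by (rule circle_proj_eqE)
    have "circle_proj (lift_section s\<^sub>2 z) = circle_proj z'"
      using z[OF True] by (simp add: circle_proj_lift_section[OF s(2)])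
    then obtain m' where m': "lift_section s\<^sub>2 z - z' = of_int m'" by (rule circle_proj_eqE)
    have tr: "lift_section s\<^sub>1 (?c + of_int k) = lift_section s\<^sub>1 ?c + of_int k" for k
      by (rule degree_one_int) (rule lift_section_add_one[OF s(1)])
    have "\<lfloor>lift_section s\<^sub>2 x - z'\<rfloor> = \<lfloor>x - z\<rfloor> + m'" for x
    proof -
      have "lift_section s\<^sub>2 x - z' = (lift_section s\<^sub>2 x - lift_section s\<^sub>2 z) + of_int m'"
        using m' by simp
      then show ?thesis
        by (metis floor_add_int floor_lift_section_diff[OF s(2)])
    qed
    then show ?thesis
      \<comment> \<open>\<open>m\<close> compares the heights of the two step functions.
        \<open>m'\<close> compares the positions of their jumps and enters through the right-hand
        side, hence with the opposite sign.\<close>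
      using m by (intro exI[of _ "m - m'"]) (simp add: selected_lift_def F tr)
  next
    case False
    have ng: "\<not> constant_off_point g" using False equi(1) by blast
    have F: "\<not> constant_off_rat f" "\<not> constant_off_rat g"
      using False ng constant_off_rat_iff f g by blast+
    obtain u v where "f u \<noteq> f v" using False unfolding constant_off_point_def by metis
    then have "(s\<^sub>1 \<circ> f) u \<noteq> (s\<^sub>1 \<circ> f) v" using bij(1) by (auto simp: bij_def dest: injD)
    moreover have "mono (lift_section s\<^sub>1 \<circ> canonical_lift f)" "mono (canonical_lift g \<circ> lift_section s\<^sub>2)"
      using canonical_lift(1)[OF f False] canonical_lift(1)[OF g ng] lift_section_mono[OF s(1)]
        lift_section_mono[OF s(2)] by (auto simp: mono_def)
    moreover have "is_lift (lift_section s\<^sub>1 \<circ> canonical_lift f) (s\<^sub>1 \<circ> f)"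
      by (intro is_lift_comp lift_section(2)[OF s(1)] canonical_lift(2)[OF f False])
    moreover have "is_lift (canonical_lift g \<circ> lift_section s\<^sub>2) (s\<^sub>1 \<circ> f)"
      unfolding eq by (intro is_lift_comp lift_section(2)[OF s(2)] canonical_lift(2)[OF g ng])
    ultimately have "\<exists>n::int. \<forall>x. (lift_section s\<^sub>1 \<circ> canonical_lift f) x =
        (canonical_lift g \<circ> lift_section s\<^sub>2) x + of_int n"
      by (intro lifts_diff_const[where f = "s\<^sub>1 \<circ> f" and u = u and v = v and F = "lift_section s\<^sub>1 \<circ> canonical_lift f"
            and G = "canonical_lift g \<circ> lift_section s\<^sub>2"])
         (simp_all add: canonical_lift_add_one lift_section_add_one[OF s(1)] lift_section_add_one[OF s(2)])
    then show ?thesis using F by (simp add: selected_lift_def)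
  qed
qed

text \<open>Evaluate \<open>lift_section f\<^sub>1 (lift_section g\<^sub>1 (A 0))\<close> in two
  ways: multiply in the group first and then pass to the second cocycle, or pass through
  \<open>B\<close> and \<open>C\<close> one factor at a time and multiply afterwards.
  \<open>A\<close>, \<open>B\<close>, \<open>C\<close> will be the selected lifts at three
  consecutive points of an orbit.\<close>

lemma euler_cocycle_difference:
  assumes f: "f\<^sub>1 \<in> carrier homeo_circle" "f\<^sub>2 \<in> carrier homeo_circle"
    and g: "g\<^sub>1 \<in> carrier homeo_circle" "g\<^sub>2 \<in> carrier homeo_circle"
    and C: "\<And>x n. C (x + of_int n) = C x + of_int n"
    and 1: "\<And>x. lift_section f\<^sub>1 (B x) = C (lift_section f\<^sub>2 x) + of_int n\<^sub>1"
    and 2: "\<And>x. lift_section g\<^sub>1 (A x) = B (lift_section g\<^sub>2 x) + of_int n\<^sub>2"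
    and 3: "\<And>x. lift_section (f\<^sub>1 \<circ> g\<^sub>1) (A x) = C (lift_section (f\<^sub>2 \<circ> g\<^sub>2) x) + of_int n\<^sub>3"
  shows "euler_cocycle f\<^sub>1 g\<^sub>1 - euler_cocycle f\<^sub>2 g\<^sub>2 = n\<^sub>2 - n\<^sub>3 + n\<^sub>1"
proof -
  have tr: "lift_section f\<^sub>1 (x + of_int k) = lift_section f\<^sub>1 x + of_int k" for x k
    by (rule degree_one_int) (rule lift_section_add_one[OF f(1)])
  have "C (lift_section (f\<^sub>2 \<circ> g\<^sub>2) 0) + of_int n\<^sub>3 + of_int (euler_cocycle f\<^sub>1 g\<^sub>1)
    = lift_section f\<^sub>1 (lift_section g\<^sub>1 (A 0))"
    unfolding euler_cocycle(1)[OF f(1) g(1)] 3 ..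
  also have "\<dots> = C (lift_section f\<^sub>2 (lift_section g\<^sub>2 0)) + of_int n\<^sub>1 + of_int n\<^sub>2"
    unfolding 2 tr 1 ..
  also have "\<dots> = C (lift_section (f\<^sub>2 \<circ> g\<^sub>2) 0) + of_int (euler_cocycle f\<^sub>2 g\<^sub>2) + of_int n\<^sub>1 + of_int n\<^sub>2"
    unfolding euler_cocycle(1)[OF f(2) g(2)] C ..
  finally have "real_of_int (euler_cocycle f\<^sub>1 g\<^sub>1 - euler_cocycle f\<^sub>2 g\<^sub>2) = of_int (n\<^sub>2 - n\<^sub>3 + n\<^sub>1)"
    by simp
  then show ?thesis by (simp only: of_int_eq_iff)
qed

section \<open>Pulling back along semicohomologous cocycles\<close>

lemma measurable_circle_proj [measurable]: "circle_proj \<in> borel \<rightarrow>\<^sub>M borel"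
  by (rule borel_measurable_continuous_onI[OF continuous_circle_proj])

context
  fixes \<phi> :: "'w \<Rightarrow> circle \<Rightarrow> circle" and M :: "'w measure" and N :: "'v measure" and \<tau> :: "'v \<Rightarrow> 'w"
  assumes \<phi>: "(\<lambda>(x, \<omega>). \<phi> \<omega> x) \<in> borel \<Otimes>\<^sub>M M \<rightarrow>\<^sub>M borel" and \<tau> [measurable]: "\<tau> \<in> N \<rightarrow>\<^sub>M M"
begin

text \<open>The change of base point \<open>\<tau>\<close> lets the same rules cover both
  \<open>\<phi>(\<omega>)\<close> and its translate at
  \<open>\<gamma>\<^sup>-\<^sup>1 \<omega>\<close>.\<close>

lemma measurable_eval [measurable]:
  assumes [measurable]: "X \<in> N \<rightarrow>\<^sub>M borel"
  shows "(\<lambda>\<omega>. \<phi> (\<tau> \<omega>) (X \<omega>)) \<in> N \<rightarrow>\<^sub>M borel"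
proof -
  have "(\<lambda>\<omega>. (X \<omega>, \<tau> \<omega>)) \<in> N \<rightarrow>\<^sub>M borel \<Otimes>\<^sub>M M" by measurable
  from measurable_compose[OF this \<phi>] show ?thesis by simp
qed

lemma measurable_eval_eq [measurable]:
  assumes [measurable]: "X \<in> N \<rightarrow>\<^sub>M borel" "Y \<in> N \<rightarrow>\<^sub>M borel"
  shows "Measurable.pred N (\<lambda>\<omega>. \<phi> (\<tau> \<omega>) (X \<omega>) = \<phi> (\<tau> \<omega>) (Y \<omega>))"
  unfolding circle_coord_eq_iff[symmetric] by measurable

lemma measurable_constant_off_rat [measurable]: "Measurable.pred N (\<lambda>\<omega>. constant_off_rat (\<phi> (\<tau> \<omega>)))"
  unfolding constant_off_rat_def by measurable

lemma measurable_generic_value [measurable]: "(\<lambda>\<omega>. generic_value (\<phi> (\<tau> \<omega>))) \<in> N \<rightarrow>\<^sub>M borel"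
  unfolding generic_value_def by measurable

lemma measurable_canonical_lift [measurable]:
  assumes [measurable]: "X \<in> N \<rightarrow>\<^sub>M borel"
  shows "(\<lambda>\<omega>. canonical_lift (\<phi> (\<tau> \<omega>)) (X \<omega>)) \<in> N \<rightarrow>\<^sub>M borel"
  unfolding canonical_lift_def by measurable

lemma measurable_selected_lift [measurable]:
  assumes [measurable]: "X \<in> N \<rightarrow>\<^sub>M borel" "Z \<in> N \<rightarrow>\<^sub>M borel"
  shows "(\<lambda>\<omega>. selected_lift (\<phi> (\<tau> \<omega>)) (Z \<omega>) (X \<omega>)) \<in> N \<rightarrow>\<^sub>M borel"
  unfolding selected_lift_def by measurable

end

text \<open>With both inversions the cocycle identity reads \<open>a(\<gamma> \<eta>, \<omega>) =
  a(\<gamma>, \<omega>) a(\<eta>, \<gamma>\<^sup>-\<^sup>1 \<omega>)\<close>, the pattern of the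
  action on functions. A relation among lifts then becomes a coboundary with coefficients in the
  module.\<close>

definition inverse_cocycle ::
  "('g, 'm) monoid_scheme \<Rightarrow> ('g \<Rightarrow> 'w \<Rightarrow> circle \<Rightarrow> circle) \<Rightarrow> 'g \<Rightarrow> 'w \<Rightarrow> circle \<Rightarrow> circle"
  where "inverse_cocycle G \<sigma> \<gamma> \<omega> = inv\<^bsub>homeo_circle\<^esub> (\<sigma> (inv\<^bsub>G\<^esub> \<gamma>) \<omega>)"

lemma cocycle_pullback_eq:
  "cocycle_pullback G M \<alpha> \<sigma> \<psi> = (\<lambda>xs\<in>tuples G 2. linf_class M (\<lambda>\<omega>.
    \<psi> [inverse_cocycle G \<sigma> (xs ! 0) \<omega>, inverse_cocycle G \<sigma> (xs ! 1) (\<alpha> (inv\<^bsub>G\<^esub> (xs ! 0)) \<omega>)]))"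
  by (simp add: cocycle_pullback_def inverse_cocycle_def Let_def)

context
  fixes G :: "('g, 'm) monoid_scheme" and M :: "'w measure" and \<alpha> :: "'g \<Rightarrow> 'w \<Rightarrow> 'w"
    and \<sigma> :: "'g \<Rightarrow> 'w \<Rightarrow> circle \<Rightarrow> circle"
  assumes act: "standard_borel_probability_action G M \<alpha>"
    and cocycle: "measurable_cocycle G M \<alpha> \<sigma>"
begin

lemma measurable_cocycle_at:
  assumes "\<gamma> \<in> carrier G"
  shows "\<sigma> \<gamma> \<in> M \<rightarrow>\<^sub>M borel_homeo_circle"
proof -
  have m: "(\<lambda>(\<gamma>, \<omega>). \<sigma> \<gamma> \<omega>) \<in> count_space (carrier G) \<Otimes>\<^sub>M M \<rightarrow>\<^sub>M borel_homeo_circle"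
    using cocycle by (simp add: measurable_cocycle_def)
  have "Pair \<gamma> \<in> M \<rightarrow>\<^sub>M count_space (carrier G) \<Otimes>\<^sub>M M"
    by (rule measurable_Pair1') (use assms in simp)
  from measurable_compose[OF this m] show ?thesis by simp
qed

lemma measurable_inverse_cocycle:
  assumes "\<gamma> \<in> carrier G"
  shows "inverse_cocycle G \<sigma> \<gamma> \<in> M \<rightarrow>\<^sub>M borel_homeo_circle"
proof -
  interpret group G using act by (rule standard_borel_probability_actionD)
  show ?thesis
    using measurable_compose[OF measurable_cocycle_at measurable_homeo_circle_inv] assms
    by (simp add: inverse_cocycle_def[abs_def])
qed

lemma inverse_cocycle_closed:
  "\<gamma> \<in> carrier G \<Longrightarrow> \<omega> \<in> space M \<Longrightarrow> inverse_cocycle G \<sigma> \<gamma> \<omega> \<in> carrier homeo_circle"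
  using measurable_space[OF measurable_inverse_cocycle] by simp

lemma cocycle_closed:
  "\<gamma> \<in> carrier G \<Longrightarrow> \<omega> \<in> space M \<Longrightarrow> \<sigma> \<gamma> \<omega> \<in> carrier homeo_circle"
  using measurable_space[OF measurable_cocycle_at] by simp

lemma action_closed:
  "\<gamma> \<in> carrier G \<Longrightarrow> \<omega> \<in> space M \<Longrightarrow> \<alpha> \<gamma> \<omega> \<in> space M"
  using measurable_space[OF standard_borel_probability_actionD(3)[OF act]] .

text \<open>Invert the cocycle identity for the pair of \<open>inv \<eta>\<close> and
  \<open>inv \<gamma>\<close>.\<close>

lemma inverse_cocycle_mult:
  assumes "\<gamma> \<in> carrier G" "\<eta> \<in> carrier G"
  shows "AE \<omega> in M. inverse_cocycle G \<sigma> (\<gamma> \<otimes>\<^bsub>G\<^esub> \<eta>) \<omega> =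
    inverse_cocycle G \<sigma> \<gamma> \<omega> \<circ> inverse_cocycle G \<sigma> \<eta> (\<alpha> (inv\<^bsub>G\<^esub> \<gamma>) \<omega>)"
proof -
  interpret group G using act by (rule standard_borel_probability_actionD)
  interpret H: group homeo_circle by (rule group_homeo_circle)
  have i: "inv\<^bsub>G\<^esub> \<gamma> \<in> carrier G" "inv\<^bsub>G\<^esub> \<eta> \<in> carrier G" using assms by simp_all
  have "AE \<omega> in M. \<sigma> (inv\<^bsub>G\<^esub> \<eta> \<otimes>\<^bsub>G\<^esub> inv\<^bsub>G\<^esub> \<gamma>) \<omega> =
      \<sigma> (inv\<^bsub>G\<^esub> \<eta>) (\<alpha> (inv\<^bsub>G\<^esub> \<gamma>) \<omega>) \<circ> \<sigma> (inv\<^bsub>G\<^esub> \<gamma>) \<omega>"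
    using cocycle i by (simp add: measurable_cocycle_def)
  with AE_space show ?thesis
  proof eventually_elim
    case (elim \<omega>)
    have "\<sigma> (inv\<^bsub>G\<^esub> \<gamma>) \<omega> \<in> carrier homeo_circle"
      "\<sigma> (inv\<^bsub>G\<^esub> \<eta>) (\<alpha> (inv\<^bsub>G\<^esub> \<gamma>) \<omega>) \<in> carrier homeo_circle"
      using elim(1) i by (auto intro!: cocycle_closed action_closed)
    from H.inv_mult_group[OF this(2,1)] show ?case
      using elim(2) assms by (simp add: inverse_cocycle_def inv_mult_group homeo_circle_mult)
  qed
qed

end

lemma inverse_cocycle_semiconjugacy:
  assumes act: "standard_borel_probability_action G M \<alpha>"
    and cocycle: "measurable_cocycle G M \<alpha> \<sigma>\<^sub>1" "measurable_cocycle G M \<alpha> \<sigma>\<^sub>2"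
    and \<gamma>: "\<gamma> \<in> carrier G"
    and eq: "AE \<omega> in M. \<sigma>\<^sub>1 (inv\<^bsub>G\<^esub> \<gamma>) \<omega> \<circ> \<phi> \<omega> = \<phi> (\<alpha> (inv\<^bsub>G\<^esub> \<gamma>) \<omega>) \<circ> \<sigma>\<^sub>2 (inv\<^bsub>G\<^esub> \<gamma>) \<omega>"
  shows "AE \<omega> in M. inverse_cocycle G \<sigma>\<^sub>1 \<gamma> \<omega> \<circ> \<phi> (\<alpha> (inv\<^bsub>G\<^esub> \<gamma>) \<omega>) = \<phi> \<omega> \<circ> inverse_cocycle G \<sigma>\<^sub>2 \<gamma> \<omega>"
proof -
  interpret group G using act by (rule standard_borel_probability_actionD)
  have i: "inv\<^bsub>G\<^esub> \<gamma> \<in> carrier G" using \<gamma> by simp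
  from AE_space eq show ?thesis
  proof eventually_elim
    case (elim \<omega>)
    note inv1 = homeo_circle_inv(2,3)[OF cocycle_closed[OF act cocycle(1) i elim(1)]]
    note inv2 = homeo_circle_inv(2,3)[OF cocycle_closed[OF act cocycle(2) i elim(1)]]
    show ?case
    proof
      fix x
      have "\<phi> (\<alpha> (inv\<^bsub>G\<^esub> \<gamma>) \<omega>) x = \<sigma>\<^sub>1 (inv\<^bsub>G\<^esub> \<gamma>) \<omega> (\<phi> \<omega> (inverse_cocycle G \<sigma>\<^sub>2 \<gamma> \<omega> x))"
        using fun_cong[OF elim(2), of "inverse_cocycle G \<sigma>\<^sub>2 \<gamma> \<omega> x"] inv2
        by (simp add: inverse_cocycle_def)
      then show "(inverse_cocycle G \<sigma>\<^sub>1 \<gamma> \<omega> \<circ> \<phi> (\<alpha> (inv\<^bsub>G\<^esub> \<gamma>) \<omega>)) x =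
          (\<phi> \<omega> \<circ> inverse_cocycle G \<sigma>\<^sub>2 \<gamma> \<omega>) x"
        using inv1 by (simp add: inverse_cocycle_def)
    qed
  qed
qed

text \<open>The second semiconjugacy is needed only where the first one is constant off one point: there
  the generic value is a \<open>\<sigma>\<^sub>1\<close>-invariant section, which \<open>\<phi>'\<close> carries to a \<open>\<sigma>\<^sub>2\<close>-invariant one.\<close>

lemma cohomology_class_cocycle_pullback_eq:
  assumes act: "standard_borel_probability_action G M \<alpha>"
    and cocycle: "measurable_cocycle G M \<alpha> \<sigma>\<^sub>1" "measurable_cocycle G M \<alpha> \<sigma>\<^sub>2"
    and left: "left_semicohomologous G M \<alpha> \<sigma>\<^sub>1 \<sigma>\<^sub>2" and right: "left_semicohomologous G M \<alpha> \<sigma>\<^sub>2 \<sigma>\<^sub>1"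
    and \<psi>: "\<psi> \<in> bounded_euler_class" "borel_cochain2 \<psi>"
  shows "cohomology_class G (linf_module G M \<alpha>) 2 (cocycle_pullback G M \<alpha> \<sigma>\<^sub>1 \<psi>)
    = cohomology_class G (linf_module G M \<alpha>) 2 (cocycle_pullback G M \<alpha> \<sigma>\<^sub>2 \<psi>)"
proof -
  interpret group G using act by (rule standard_borel_probability_actionD)
  interpret action: group_action G "space M" \<alpha> using act by (rule standard_borel_probability_actionD)
  obtain \<phi> :: "'c \<Rightarrow> circle \<Rightarrow> circle" where \<phi>: "(\<lambda>(x, \<omega>). \<phi> \<omega> x) \<in> borel \<Otimes>\<^sub>M M \<rightarrow>\<^sub>M borel"
    and \<phi>_mono: "AE \<omega> in M. nondecreasing_degree_one (\<phi> \<omega>)"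
    and \<phi>_eq: "\<And>\<gamma>. \<gamma> \<in> carrier G \<Longrightarrow> AE \<omega> in M. \<sigma>\<^sub>1 \<gamma> \<omega> \<circ> \<phi> \<omega> = \<phi> (\<alpha> \<gamma> \<omega>) \<circ> \<sigma>\<^sub>2 \<gamma> \<omega>"
    using left unfolding left_semicohomologous_def by blast
  obtain \<phi>' :: "'c \<Rightarrow> circle \<Rightarrow> circle" where \<phi>': "(\<lambda>(x, \<omega>). \<phi>' \<omega> x) \<in> borel \<Otimes>\<^sub>M M \<rightarrow>\<^sub>M borel"
    and \<phi>'_eq: "\<And>\<gamma>. \<gamma> \<in> carrier G \<Longrightarrow> AE \<omega> in M. \<sigma>\<^sub>2 \<gamma> \<omega> \<circ> \<phi>' \<omega> = \<phi>' (\<alpha> \<gamma> \<omega>) \<circ> \<sigma>\<^sub>1 \<gamma> \<omega>"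
    using right unfolding left_semicohomologous_def by blast
  obtain \<beta> :: "(circle \<Rightarrow> circle) \<Rightarrow> int" and C :: real where
    \<beta>_bdd: "\<And>f. f \<in> carrier homeo_circle \<Longrightarrow> \<bar>of_int (\<beta> f)\<bar> \<le> C" and
    \<psi>_eq: "\<And>f g. f \<in> carrier homeo_circle \<Longrightarrow> g \<in> carrier homeo_circle \<Longrightarrow>
      \<psi> [f, g] = \<beta> g - \<beta> (f \<circ> g) + \<beta> f + euler_cocycle f g"
    using bounded_euler_class_elim[OF \<psi>(1)] by metis
  have \<psi>_meas: "(\<lambda>(f, g). \<psi> [f, g]) \<in> borel_homeo_circle \<Otimes>\<^sub>M borel_homeo_circle \<rightarrow>\<^sub>M count_space UNIV"
    using \<psi>(2) by (simp add: borel_cochain2_def)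
  \<comment> \<open>The coboundary of \<open>\<beta>\<close> is \<open>\<psi>\<close> minus the
    Euler cocycle, a difference of Borel functions.\<close>
  have \<beta>_meas: "\<beta> \<in> borel_homeo_circle \<rightarrow>\<^sub>M count_space UNIV"
  proof (rule measurable_of_coboundary[OF \<beta>_bdd])
    note [measurable] = \<psi>_meas
    let ?d = "\<lambda>p. (case p of (f, g) \<Rightarrow> \<psi> [f, g]) - euler_cocycle (fst p) (snd p)"
    have eq: "(case p of (f, g) \<Rightarrow> \<beta> g - \<beta> (f \<circ> g) + \<beta> f) = ?d p"
      if "p \<in> space (borel_homeo_circle \<Otimes>\<^sub>M borel_homeo_circle)" for p
    proof -
      obtain f g where p: "p = (f, g)" by (cases p)
      have "f \<in> carrier homeo_circle" "g \<in> carrier homeo_circle"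
        using that by (simp_all add: p space_pair_measure)
      from \<psi>_eq[OF this] show ?thesis by (simp add: p)
    qed
    show "(\<lambda>(f, g). \<beta> g - \<beta> (f \<circ> g) + \<beta> f)
        \<in> borel_homeo_circle \<Otimes>\<^sub>M borel_homeo_circle \<rightarrow>\<^sub>M count_space UNIV"
    proof (subst measurable_cong[where g = ?d])
      show "?d \<in> borel_homeo_circle \<Otimes>\<^sub>M borel_homeo_circle \<rightarrow>\<^sub>M count_space UNIV"
        by measurable
    qed (erule eq)
  qed

  define a\<^sub>1 where "a\<^sub>1 = inverse_cocycle G \<sigma>\<^sub>1"
  define a\<^sub>2 where "a\<^sub>2 = inverse_cocycle G \<sigma>\<^sub>2"
  note a\<^sub>1 = measurable_inverse_cocycle[OF act cocycle(1), folded a\<^sub>1_def]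
  note a\<^sub>2 = measurable_inverse_cocycle[OF act cocycle(2), folded a\<^sub>2_def]
  note a\<^sub>1_closed = inverse_cocycle_closed[OF act cocycle(1), folded a\<^sub>1_def]
  note a\<^sub>2_closed = inverse_cocycle_closed[OF act cocycle(2), folded a\<^sub>2_def]
  note act_closed = action_closed[OF act cocycle(1)]
  \<comment> \<open>Defined for every \<open>\<omega>\<close>, which keeps it Borel without a case
    distinction; \<open>selected_lift\<close> reads it only where \<open>\<phi> \<omega>\<close>
    passes the test \<open>constant_off_rat\<close>.\<close>
  define Z where "Z \<omega> = circle_coord (\<phi>' \<omega> (generic_value (\<phi> \<omega>)))" for \<omega>
  define \<Phi> where "\<Phi> \<omega> = selected_lift (\<phi> \<omega>) (Z \<omega>)" for \<omega>
  \<comment> \<open>The difference is an integer almost everywhere. The floor makes \<open>n\<close>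
    integer valued at every \<open>\<omega>\<close>, so that measurability and the bound need no
    exceptional null set.\<close>
  define n where "n \<gamma> \<omega> = \<lfloor>lift_section (a\<^sub>1 \<gamma> \<omega>) (\<Phi> (\<alpha> (inv\<^bsub>G\<^esub> \<gamma>) \<omega>) 0)
    - \<Phi> \<omega> (lift_section (a\<^sub>2 \<gamma> \<omega>) 0)\<rfloor>" for \<gamma> \<omega>
  have \<Phi>_meas: "(\<lambda>\<omega>. \<Phi> (\<tau> \<omega>) (X \<omega>)) \<in> M \<rightarrow>\<^sub>M borel"
    if \<tau> [measurable]: "\<tau> \<in> M \<rightarrow>\<^sub>M M" and [measurable]: "X \<in> M \<rightarrow>\<^sub>M borel" for \<tau> X
  proof -
    have "(\<lambda>\<omega>. Z (\<tau> \<omega>)) \<in> M \<rightarrow>\<^sub>M borel" 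
      unfolding Z_def
      by (rule measurable_compose[OF measurable_eval[OF \<phi>' \<tau> measurable_generic_value[OF \<phi> \<tau>]]
            circle_coord_measurable])
    then show ?thesis unfolding \<Phi>_def by (intro measurable_selected_lift[OF \<phi> \<tau>] that)
  qed
  have n_meas: "n \<gamma> \<in> M \<rightarrow>\<^sub>M count_space UNIV" if \<gamma>: "\<gamma> \<in> carrier G" for \<gamma>
  proof -
    have i: "inv\<^bsub>G\<^esub> \<gamma> \<in> carrier G" using \<gamma> by simp
    note [measurable] = a\<^sub>1[OF \<gamma>] a\<^sub>2[OF \<gamma>]
    have [measurable]: "(\<lambda>\<omega>. \<Phi> (\<alpha> (inv\<^bsub>G\<^esub> \<gamma>) \<omega>) 0) \<in> M \<rightarrow>\<^sub>M borel"
      by (rule \<Phi>_meas) (use standard_borel_probability_actionD(3)[OF act i] in auto)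
    have [measurable]: "(\<lambda>\<omega>. \<Phi> \<omega> (lift_section (a\<^sub>2 \<gamma> \<omega>) 0)) \<in> M \<rightarrow>\<^sub>M borel"
      by (rule \<Phi>_meas) measurable
    show ?thesis unfolding n_def by measurable
  qed
  \<comment> \<open>On [0, 1) the lifts take values in [-1, 3]. The section of
    \<open>a\<^sub>1\<close> maps this interval into [-1, 4], so the difference lies between -4 and
    5.\<close>
  have n_bdd: "\<bar>n \<gamma> \<omega>\<bar> \<le> 5" if \<gamma>: "\<gamma> \<in> carrier G" and \<omega>: "\<omega> \<in> space M" for \<gamma> \<omega>
  proof -
    note A = a\<^sub>1_closed[OF \<gamma> \<omega>] and B = lift_section(3,4)[OF a\<^sub>2_closed[OF \<gamma> \<omega>]]
    have bds: "- 1 \<le> \<Phi> w x" "\<Phi> w x \<le> 3" if "0 \<le> x" "x < 1" for w x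
      unfolding \<Phi>_def Z_def using that by (intro selected_lift_bounds circle_coord_bounds; simp)+
    let ?y = "\<Phi> (\<alpha> (inv\<^bsub>G\<^esub> \<gamma>) \<omega>) 0"
    have tr: "lift_section (a\<^sub>1 \<gamma> \<omega>) (0 + of_int k) = lift_section (a\<^sub>1 \<gamma> \<omega>) 0 + of_int k" for k
      by (rule degree_one_int) (rule lift_section_add_one[OF A])
    have "lift_section (a\<^sub>1 \<gamma> \<omega>) (0 + of_int (- 1)) \<le> lift_section (a\<^sub>1 \<gamma> \<omega>) ?y"
      "lift_section (a\<^sub>1 \<gamma> \<omega>) ?y \<le> lift_section (a\<^sub>1 \<gamma> \<omega>) (0 + of_int 3)"
      using bds[of 0 "\<alpha> (inv\<^bsub>G\<^esub> \<gamma>) \<omega>"] by (intro monoD[OF lift_section_mono[OF A]]; simp)+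
    then have "- 1 \<le> lift_section (a\<^sub>1 \<gamma> \<omega>) ?y" "lift_section (a\<^sub>1 \<gamma> \<omega>) ?y \<le> 4"
      unfolding tr using lift_section(3,4)[OF A] by simp_all
    then show ?thesis
      using bds[OF B, of \<omega>] unfolding n_def by linarith
  qed
  have key: "AE \<omega> in M. \<forall>x. lift_section (a\<^sub>1 \<gamma> \<omega>) (\<Phi> (\<alpha> (inv\<^bsub>G\<^esub> \<gamma>) \<omega>) x) =
      \<Phi> \<omega> (lift_section (a\<^sub>2 \<gamma> \<omega>) x) + of_int (n \<gamma> \<omega>)" if \<gamma>: "\<gamma> \<in> carrier G" for \<gamma>
  proof -
    have i: "inv\<^bsub>G\<^esub> \<gamma> \<in> carrier G" using \<gamma> by simp
    note e1 = inverse_cocycle_semiconjugacy[OF act cocycle \<gamma> \<phi>_eq[OF i], folded a\<^sub>1_def a\<^sub>2_def]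
    note e2 = inverse_cocycle_semiconjugacy[OF act cocycle(2,1) \<gamma> \<phi>'_eq[OF i], folded a\<^sub>1_def a\<^sub>2_def]
    from AE_space \<phi>_mono standard_borel_probability_actionD(4)[OF act i \<phi>_mono] e1 e2 show ?thesis
    proof eventually_elim
      case (elim \<omega>)
      let ?\<omega>' = "\<alpha> (inv\<^bsub>G\<^esub> \<gamma>) \<omega>"
      note A = a\<^sub>1_closed[OF \<gamma> elim(1)] and B = a\<^sub>2_closed[OF \<gamma> elim(1)]
      \<comment> \<open>Generic values follow \<open>a\<^sub>1\<close>, and \<open>\<phi>'\<close>
        intertwines \<open>a\<^sub>1\<close> with \<open>a\<^sub>2\<close>, so the jumps follow
        \<open>a\<^sub>2\<close>.\<close>
      have "a\<^sub>2 \<gamma> \<omega> (circle_proj (Z ?\<omega>')) = circle_proj (Z \<omega>)" if "constant_off_point (\<phi> ?\<omega>')"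
      proof -
        have "a\<^sub>2 \<gamma> \<omega> (\<phi>' ?\<omega>' p) = \<phi>' \<omega> (a\<^sub>1 \<gamma> \<omega> p)" for p
          using elim(5) by (metis comp_apply)
        moreover have "generic_value (\<phi> \<omega>) = a\<^sub>1 \<gamma> \<omega> (generic_value (\<phi> ?\<omega>'))"
          by (rule constant_off_point_equivariant(2)[OF homeo_circleD(2)[OF A] homeo_circleD(2)[OF B]
                elim(4) that])
        ultimately show ?thesis by (simp add: Z_def)
      qed
      from selected_lift_equivariant[OF A B elim(3,2,4) this]
      obtain m :: int where m: "\<And>x. lift_section (a\<^sub>1 \<gamma> \<omega>) (\<Phi> ?\<omega>' x) =
          \<Phi> \<omega> (lift_section (a\<^sub>2 \<gamma> \<omega>) x) + of_int m"
        unfolding \<Phi>_def by blast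
      then have "n \<gamma> \<omega> = m" by (simp add: n_def)
      then show ?case using m by simp
    qed
  qed

  let ?h = "\<lambda>\<gamma> \<omega>. n \<gamma> \<omega> + \<beta> (a\<^sub>1 \<gamma> \<omega>) - \<beta> (a\<^sub>2 \<gamma> \<omega>)"
  have pull: "(\<lambda>\<omega>. \<psi> [a \<gamma> \<omega>, a \<eta> (\<alpha> (inv\<^bsub>G\<^esub> \<gamma>) \<omega>)]) \<in> carrier (linf_fun_group M)"
    if a: "\<And>\<gamma>. \<gamma> \<in> carrier G \<Longrightarrow> a \<gamma> \<in> M \<rightarrow>\<^sub>M borel_homeo_circle"
      and \<gamma>: "\<gamma> \<in> carrier G" and \<eta>: "\<eta> \<in> carrier G" for a \<gamma> \<eta>
  proof -
    have i: "inv\<^bsub>G\<^esub> \<gamma> \<in> carrier G" using \<gamma> by simp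
    note [measurable] = a[OF \<gamma>] measurable_compose[OF standard_borel_probability_actionD(3)[OF act i] a[OF \<eta>]]
    have pair: "(\<lambda>\<omega>. (a \<gamma> \<omega>, a \<eta> (\<alpha> (inv\<^bsub>G\<^esub> \<gamma>) \<omega>)))
        \<in> M \<rightarrow>\<^sub>M borel_homeo_circle \<Otimes>\<^sub>M borel_homeo_circle"
      by measurable
    show ?thesis
    proof (rule linf_fun_groupI)
      show "(\<lambda>\<omega>. \<psi> [a \<gamma> \<omega>, a \<eta> (\<alpha> (inv\<^bsub>G\<^esub> \<gamma>) \<omega>)]) \<in> M \<rightarrow>\<^sub>M count_space UNIV"
        using measurable_compose[OF pair \<psi>_meas] by simp
      \<comment> \<open>Three values of \<open>\<beta>\<close> and one of the Euler cocycle.\<close>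
      have "\<bar>\<psi> [f, g]\<bar> \<le> 3 * \<lfloor>C\<rfloor> + 1"
        if f: "f \<in> carrier homeo_circle" and g: "g \<in> carrier homeo_circle" for f g
      proof -
        have "\<bar>\<beta> k\<bar> \<le> \<lfloor>C\<rfloor>" if "k \<in> carrier homeo_circle" for k
          using \<beta>_bdd[OF that] by linarith
        from this[OF f] this[OF g] this[OF homeo_circle_comp[OF f g]] show ?thesis
          using euler_cocycle_bounds[OF f g] unfolding \<psi>_eq[OF f g] by linarith
      qed
      moreover have "a \<gamma> \<omega> \<in> carrier homeo_circle"
        "a \<eta> (\<alpha> (inv\<^bsub>G\<^esub> \<gamma>) \<omega>) \<in> carrier homeo_circle" if "\<omega> \<in> space M" for \<omega>
        using measurable_space[OF a[OF \<gamma>] that] measurable_space[OF a[OF \<eta>] act_closed[OF i that]]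
        by simp_all
      ultimately show "AE \<omega> in M. \<bar>\<psi> [a \<gamma> \<omega>, a \<eta> (\<alpha> (inv\<^bsub>G\<^esub> \<gamma>) \<omega>)]\<bar> \<le> 3 * \<lfloor>C\<rfloor> + 1"
        by (intro AE_I2) blast
    qed
  qed
  show ?thesis
    unfolding cocycle_pullback_eq a\<^sub>1_def[symmetric] a\<^sub>2_def[symmetric]
  proof (rule linf_cohomology_class_eq[OF act, where h = ?h and C = "5 + 2 * C"
        and \<Psi>\<^sub>1 = "\<lambda>\<gamma> \<eta> \<omega>. \<psi> [a\<^sub>1 \<gamma> \<omega>, a\<^sub>1 \<eta> (\<alpha> (inv\<^bsub>G\<^esub> \<gamma>) \<omega>)]"
        and \<Psi>\<^sub>2 = "\<lambda>\<gamma> \<eta> \<omega>. \<psi> [a\<^sub>2 \<gamma> \<omega>, a\<^sub>2 \<eta> (\<alpha> (inv\<^bsub>G\<^esub> \<gamma>) \<omega>)]", OF pull[OF a\<^sub>1] pull[OF a\<^sub>2]])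
    fix \<gamma> assume \<gamma>: "\<gamma> \<in> carrier G"
    note [measurable] = n_meas[OF \<gamma>] measurable_compose[OF a\<^sub>1[OF \<gamma>] \<beta>_meas]
      measurable_compose[OF a\<^sub>2[OF \<gamma>] \<beta>_meas]
    show "?h \<gamma> \<in> M \<rightarrow>\<^sub>M count_space UNIV" by measurable
    show "\<bar>real_of_int (?h \<gamma> \<omega>)\<bar> \<le> 5 + 2 * C" if "\<omega> \<in> space M" for \<omega>
      using n_bdd[OF \<gamma> that] \<beta>_bdd[OF a\<^sub>1_closed[OF \<gamma> that]] \<beta>_bdd[OF a\<^sub>2_closed[OF \<gamma> that]]
      by linarith
    fix \<eta> assume \<eta>: "\<eta> \<in> carrier G"
    have i: "inv\<^bsub>G\<^esub> \<gamma> \<in> carrier G" using \<gamma> by simp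
    \<comment> \<open>The identities at \<open>(\<gamma>, \<omega>)\<close>,
      \<open>(\<eta>, \<gamma>\<^sup>-\<^sup>1 \<omega>)\<close> and
      \<open>(\<gamma> \<eta>, \<omega>)\<close> are the three inputs of
      \<open>euler_cocycle_difference\<close>; measure preservation gives the second.\<close>
    from AE_space key[OF \<gamma>] standard_borel_probability_actionD(4)[OF act i key[OF \<eta>]] key[OF m_closed[OF \<gamma> \<eta>]]
      inverse_cocycle_mult[OF act cocycle(1) \<gamma> \<eta>, folded a\<^sub>1_def]
      inverse_cocycle_mult[OF act cocycle(2) \<gamma> \<eta>, folded a\<^sub>2_def]
    show "AE \<omega> in M. \<psi> [a\<^sub>1 \<gamma> \<omega>, a\<^sub>1 \<eta> (\<alpha> (inv\<^bsub>G\<^esub> \<gamma>) \<omega>)] - \<psi> [a\<^sub>2 \<gamma> \<omega>, a\<^sub>2 \<eta> (\<alpha> (inv\<^bsub>G\<^esub> \<gamma>) \<omega>)]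
      = ?h \<eta> (\<alpha> (inv\<^bsub>G\<^esub> \<gamma>) \<omega>) - ?h (\<gamma> \<otimes>\<^bsub>G\<^esub> \<eta>) \<omega> + ?h \<gamma> \<omega>"
    proof eventually_elim
      case (elim \<omega>)
      let ?\<omega>' = "\<alpha> (inv\<^bsub>G\<^esub> \<gamma>) \<omega>"
      have \<omega>': "?\<omega>' \<in> space M" using i elim(1) by (rule act_closed)
      have "\<alpha> (inv\<^bsub>G\<^esub> (\<gamma> \<otimes>\<^bsub>G\<^esub> \<eta>)) \<omega> = \<alpha> (inv\<^bsub>G\<^esub> \<eta>) ?\<omega>'"
        using action.composition_rule[OF elim(1), of "inv\<^bsub>G\<^esub> \<eta>" "inv\<^bsub>G\<^esub> \<gamma>"] \<gamma> \<eta>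
        by (simp add: inv_mult_group)
      then have "euler_cocycle (a\<^sub>1 \<gamma> \<omega>) (a\<^sub>1 \<eta> ?\<omega>') - euler_cocycle (a\<^sub>2 \<gamma> \<omega>) (a\<^sub>2 \<eta> ?\<omega>')
          = n \<eta> ?\<omega>' - n (\<gamma> \<otimes>\<^bsub>G\<^esub> \<eta>) \<omega> + n \<gamma> \<omega>"
        using elim(2-6) selected_lift_add_int
        by (intro euler_cocycle_difference[where A = "\<Phi> (\<alpha> (inv\<^bsub>G\<^esub> \<eta>) ?\<omega>')" and B = "\<Phi> ?\<omega>'"
              and C = "\<Phi> \<omega>"] a\<^sub>1_closed a\<^sub>2_closed \<gamma> \<eta> elim(1) \<omega>')
           (simp_all add: \<Phi>_def)
      then show ?case
        using a\<^sub>1_closed[OF \<gamma> elim(1)] a\<^sub>1_closed[OF \<eta> \<omega>'] a\<^sub>2_closed[OF \<gamma> elim(1)] a\<^sub>2_closed[OF \<eta> \<omega>']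
        by (simp add: \<psi>_eq elim(5,6))
    qed
  qed
qed

theorem theorem5p4:
  fixes \<Gamma> :: "('g, 'm) monoid_scheme"
    and \<Omega> :: "'w measure"
    and \<alpha> :: "'g \<Rightarrow> 'w \<Rightarrow> 'w"
    and \<sigma>\<^sub>1 \<sigma>\<^sub>2 :: "'g \<Rightarrow> 'w \<Rightarrow> circle \<Rightarrow> circle"
  assumes "finitely_generated_group \<Gamma>"
    and "standard_borel_probability_action \<Gamma> \<Omega> \<alpha>"
    and "ergodic_action \<Gamma> \<Omega> \<alpha>"
    and "measurable_cocycle \<Gamma> \<Omega> \<alpha> \<sigma>\<^sub>1"
    and "measurable_cocycle \<Gamma> \<Omega> \<alpha> \<sigma>\<^sub>2"
    and "semicohomologous \<Gamma> \<Omega> \<alpha> \<sigma>\<^sub>1 \<sigma>\<^sub>2"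
  shows "cohomology_map2 \<Gamma> \<Omega> \<alpha> \<sigma>\<^sub>1 bounded_euler_class
    = cohomology_map2 \<Gamma> \<Omega> \<alpha> \<sigma>\<^sub>2 bounded_euler_class"
proof -
  have "left_semicohomologous \<Gamma> \<Omega> \<alpha> \<sigma>\<^sub>1 \<sigma>\<^sub>2" "left_semicohomologous \<Gamma> \<Omega> \<alpha> \<sigma>\<^sub>2 \<sigma>\<^sub>1"
    using assms(6) by (simp_all add: semicohomologous_def right_semicohomologous_def)
  note eq = cohomology_class_cocycle_pullback_eq[OF assms(2,4,5) this]
  show ?thesis
    \<comment> \<open>\<open>eq\<close> holds for each Borel \<open>\<psi>\<close> in the class, so
      the conditions under the two \<open>THE\<close> operators are the same predicate of
      \<open>d\<close>.\<close>
    unfolding cohomology_map2_def by (intro arg_cong[where f = The] ext) (metis eq)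
qed

end
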